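(* Suppose that $\Gamma$ is a finite set. Let $(x,\sigma)$, with $\sigma\in\mathcal{S}_e\cap\mathcal{S}_d$, be a forward complete trajectory of $\dot x=f(x,\sigma)$. For each $\gamma\in\Gamma$ let $E_\gamma=\{\xi\in\chi_\gamma:f_\gamma(\xi)=0\}$. For $V\in\mathcal{V}$ and a family $\{W_\gamma:\mathcal{O}_\gamma\to\mathbb{R},\gamma\in\Gamma\}$ consider the inequality $$(\ast)\qquad -\nabla V_\gamma(\xi)f_\gamma(\xi)\ge W_\gamma(\xi)\ge0\qquad\forall\xi\in\mathcal{O}_\gamma,\ \forall\gamma\in\Gamma.$$ Then the following holds. 1. Suppose there exist $V\in\mathcal{V}$, whose restriction to $\mathrm{dom}(f)\cap(\mathcal{O}\times\Gamma)$ is continuous, and a family $\{W_\gamma:\mathcal{O}_\gamma\to\mathbb{R},\gamma\in\Gamma\}$ such that $(x,\sigma)$ is precompact relative to $\mathcal{O}$, $v(t)=V(x(t),\sigma(t))$ is nonincreasing on $[0,+\infty)$ and $(\ast)$ holds, and suppose that for every $\gamma\in\Gamma$ either $\mathcal{O}_\gamma^b(f_\gamma,W_\gamma)=E_\gamma\cap\mathcal{O}_\gamma$ or $\mathcal{O}_\gamma^f(f_\gamma,W_\gamma)=E_\gamma\cap\mathcal{O}_\gamma$. Then there exists $c\in\mathbb{R}$ such that $x\to\bigcap_{\gamma\in\Gamma}(E_\gamma\cap V_\gamma^{-1}(c))$. If, in addition, for each $c\in\mathbb{R}$ the set $\bigcap_{\gamma\in\Gamma}(E_\gamma\cap V_\gamma^{-1}(c))$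 is discrete, then $x\to x_e$ for some $x_e\in\bigcap_{\gamma\in\Gamma}(E_\gamma\cap\mathcal{O}_\gamma)$. 2. Suppose there exist $V\in\mathcal{V}$ and a family $\{W_\gamma:\mathcal{O}_\gamma\to\mathbb{R},\gamma\in\Gamma\}$ such that $(x,\sigma)$ is precompact relative to $\mathcal{O}$, for every $\gamma\in\Gamma$ the function $v(t)=V(x(t),\sigma(t))$ is nonincreasing on $\sigma^{-1}(\gamma)\cap[0,+\infty)$, and $(\ast)$ holds, and suppose that for every $\gamma\in\Gamma$ either $\mathcal{O}_\gamma^b(f_\gamma,W_\gamma)=E_\gamma\cap\mathcal{O}_\gamma$ or $\mathcal{O}_\gamma^f(f_\gamma,W_\gamma)=E_\gamma\cap\mathcal{O}_\gamma$. Then $x\to\bigcap_{\gamma\in\Gamma}(E_\gamma\cap\mathcal{O}_\gamma)$. If, in addition, $\bigcap_{\gamma\in\Gamma}(E_\gamma\cap\mathcal{O}_\gamma)$ is a discrete set, then $x\to x_e$ for some $x_e\in\bigcap_{\gamma\in\Gamma}(E_\gamma\cap\mathcal{O}_\gamma)$.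
   Context: Setting: $\Gamma$ is a compact metric space (here finite), $\mathrm{dom}(f)\subset\mathbb{R}^n\times\Gamma$ is closed and $f:\mathrm{dom}(f)\to\mathbb{R}^n$ is continuous. For $\gamma\in\Gamma$, $\chi_\gamma=\{\xi\in\mathbb{R}^n:(\xi,\gamma)\in\mathrm{dom}(f)\}$ and $f_\gamma:\chi_\gamma\to\mathbb{R}^n$, $f_\gamma(\xi)=f(\xi,\gamma)$. A switching signal is a function $\sigma:\mathbb{R}\to\Gamma$ that is piecewise constant (at most finitely many jumps in each compact interval) and continuous from the right; $\Lambda(\sigma)$ is the set of times at which $\sigma$ has a jump. A solution of $\dot x=f(x,\sigma)$ corresponding to $\sigma$ is a locally absolutely continuous $x:I_x\to\mathbb{R}^n$, $I_x\subset\mathbb{R}$ a nonempty interval, with $(x(t),\sigma(t))\in\mathrm{dom}(f)$ for all $t\in I_x$ and $\dot x(t)=f(x(t),\sigma(t))$ for almost all $t\in I_x$. Then $(x,\sigma)$ is called a trajectory; it is forward complete if $\mathbb{R}_{\ge0}\subset I_x$. It is precompact relative to $\mathcal{O}\subset\mathbb{R}^n$ if there is a compact set $B\subset\mathcal{O}$ with $x(t)\in B$ for all $t\in I_x$. $\mathcal{S}_d=\bigcup_{\tau_D>0}\mathcal{S}_d[\tau_D]$, where $\mathcal{S}_d[\tau_D]$ is the set of switching signals with $|t-t'|\ge\tau_D$ for all $t\ne t'$ in $\Lambda(\sigma)$. $\mathcal{S}_e=\bigcup_{T>0}\mathcal{S}_e[T]$, where (for $\Gamma$ finite) $\mathcal{S}_e[T]$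 is the set of switching signals $\sigma$ such that $\sigma^{-1}(\gamma)\cap[t_0,t_0+T]\ne\emptyset$ for every $t_0\ge0$ and every $\gamma\in\Gamma$. For $M\subset\mathbb{R}^n$, $x\to M$ means $\lim_{t\to+\infty}d(x(t),M)=0$, where $d(\xi,M)=\inf_{\nu\in M}|\nu-\xi|$; $x\to x_e$ means $\lim_{t\to+\infty}x(t)=x_e$. $\pi_1:\mathbb{R}^n\times\Gamma\to\mathbb{R}^n$ is the projection onto the first component. Class $\mathcal{V}$: $V:\mathrm{dom}(V)\to\mathbb{R}$ belongs to $\mathcal{V}$ if $\mathrm{dom}(V)\subset\mathbb{R}^n\times\Gamma$; for every $\gamma\in\Gamma$ the set $\mathcal{D}_\gamma=\{\xi:(\xi,\gamma)\in\mathrm{dom}(V)\}$ is open; with $\mathcal{O}=\pi_1(\mathrm{dom}(V))$ and $\mathcal{O}_\gamma=\mathcal{O}\cap\chi_\gamma$, one has $\mathcal{O}_\gamma\subset\mathcal{D}_\gamma$ for all $\gamma$; and for all $\gamma$, $V_\gamma(\cdot)=V(\cdot,\gamma)$ is differentiable on $\mathcal{O}_\gamma$. ($\mathcal{O}$ and $\mathcal{O}_\gamma$ always refer to the function $V$ under consideration.) Observability-like sets: given $\mathcal{X}\subset\mathbb{R}^n$, a continuous map $g:\mathcal{X}\to\mathbb{R}^n$, a function $h:\mathcal{X}\to\mathbb{R}$ and $\tau>0$, $\mathcal{X}^f(g,h,\tau)$ (resp. $\mathcal{X}^b(g,h,\tau)$) is the set of $\xi\in\mathcal{X}$ for which there is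 a solution $\varphi:[0,\tau]\to\mathcal{X}$ (resp. $\varphi:[-\tau,0]\to\mathcal{X}$) of $\dot x=g(x)$ with $\varphi(0)=\xi$ and $h(\varphi(t))=0$ for all $t\in[0,\tau]$ (resp. $t\in[-\tau,0]$). Also $\mathcal{X}^f(g,h)=\bigcup_{\tau>0}\mathcal{X}^f(g,h,\tau)$ and $\mathcal{X}^b(g,h)=\bigcup_{\tau>0}\mathcal{X}^b(g,h,\tau)$. The sets $\mathcal{O}_\gamma^f(f_\gamma,W_\gamma)$, $\mathcal{O}_\gamma^b(f_\gamma,W_\gamma)$ are these sets with $\mathcal{X}=\mathcal{O}_\gamma$, $g=f_\gamma|_{\mathcal{O}_\gamma}$, $h=W_\gamma$. *)

theory Defs
  imports "HOL-Analysis.Analysis"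
begin

text \<open>
  The compact metric space \<open>\<Gamma>\<close> is a type \<open>'g\<close> of class \<open>metric_space\<close>; finiteness is imposed by the
  class \<open>finite\<close>, so every \<open>\<gamma> :: 'g\<close> is an element of \<open>\<Gamma>\<close> and compactness is automatic.
  A partial map on \<open>\<real>\<^sup>n \<times> \<Gamma>\<close> is a total function together with an explicit domain
  (\<open>domf\<close> for \<open>f\<close>, \<open>domV\<close> for \<open>V\<close>); its values outside of the domain are never used.
\<close>

subsection \<open>Switching signals\<close>

text \<open>For a piecewise constant signal, the jumps are exactly the discontinuities.\<close>

definition jump_times :: "(real \<Rightarrow> 'g::metric_space) \<Rightarrow> real set" where
  "jump_times \<sigma> = {t. \<not> isCont \<sigma> t}"

definition piecewise_constant :: "(real \<Rightarrow> 'g::metric_space) \<Rightarrow> bool" where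
  "piecewise_constant \<sigma> \<longleftrightarrow>
     (\<forall>a b. finite (jump_times \<sigma> \<inter> {a..b})) \<and>
     (\<forall>a b. jump_times \<sigma> \<inter> {a<..<b} = {} \<longrightarrow> \<sigma> constant_on {a<..<b})"

definition switching_signal :: "(real \<Rightarrow> 'g::metric_space) \<Rightarrow> bool" where
  "switching_signal \<sigma> \<longleftrightarrow> piecewise_constant \<sigma> \<and> (\<forall>t. continuous (at_right t) \<sigma>)"

definition dwell_time_signals :: "real \<Rightarrow> (real \<Rightarrow> 'g::metric_space) set" where
  "dwell_time_signals \<tau>D = {\<sigma>. switching_signal \<sigma> \<and>
     (\<forall>t\<in>jump_times \<sigma>. \<forall>t'\<in>jump_times \<sigma>. t \<noteq> t' \<longrightarrow> \<bar>t - t'\<bar> \<ge> \<tau>D)}"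

definition Sd :: "(real \<Rightarrow> 'g::metric_space) set" where
  "Sd = (\<Union>\<tau>D\<in>{0<..}. dwell_time_signals \<tau>D)"

definition ergodic_signals :: "real \<Rightarrow> (real \<Rightarrow> 'g::{finite,metric_space}) set" where
  "ergodic_signals T = {\<sigma>. switching_signal \<sigma> \<and>
     (\<forall>t0\<ge>0. \<forall>\<gamma>. \<sigma> -` {\<gamma>} \<inter> {t0..t0 + T} \<noteq> {})}"

definition Se :: "(real \<Rightarrow> 'g::{finite,metric_space}) set" where
  "Se = (\<Union>T\<in>{0<..}. ergodic_signals T)"

subsection \<open>Solutions and trajectories\<close>

text \<open>
  Usual epsilon-delta definition: \<open>d\<close> ranges over the finite families of non-overlapping compact
  intervals \<open>k = {Inf k..Sup k}\<close> contained in \<open>{a..b}\<close>.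
\<close>

definition absolutely_continuous_on_interval ::
    "real \<Rightarrow> real \<Rightarrow> (real \<Rightarrow> 'a::real_normed_vector) \<Rightarrow> bool" where
  "absolutely_continuous_on_interval a b x \<longleftrightarrow>
     (\<forall>\<epsilon>>0. \<exists>\<delta>>0. \<forall>d. d division_of \<Union>d \<and> \<Union>d \<subseteq> {a..b} \<and> (\<Sum>k\<in>d. Sup k - Inf k) < \<delta> \<longrightarrow>
        (\<Sum>k\<in>d. norm (x (Sup k) - x (Inf k))) < \<epsilon>)"

definition locally_absolutely_continuous_on ::
    "real set \<Rightarrow> (real \<Rightarrow> 'a::real_normed_vector) \<Rightarrow> bool" where
  "locally_absolutely_continuous_on I x \<longleftrightarrow>
     (\<forall>a b. {a..b} \<subseteq> I \<longrightarrow> absolutely_continuous_on_interval a b x)"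

text \<open>
  \<open>ode_solution F I x\<close>: \<open>x\<close> is a Caratheodory solution of \<open>x'(t) = F t (x t)\<close> on the interval \<open>I\<close>.
  Since the endpoints of \<open>I\<close> form a null set, \<open>at t within I\<close> may be read as \<open>at t\<close>.
\<close>

definition ode_solution ::
    "(real \<Rightarrow> 'a \<Rightarrow> 'a) \<Rightarrow> real set \<Rightarrow> (real \<Rightarrow> 'a::real_normed_vector) \<Rightarrow> bool" where
  "ode_solution F I x \<longleftrightarrow>
     is_interval I \<and> I \<noteq> {} \<and> locally_absolutely_continuous_on I x \<and>
     (AE t in lebesgue. t \<in> I \<longrightarrow> (x has_vector_derivative F t (x t)) (at t within I))"

definition trajectory ::
    "('a::real_normed_vector \<times> 'g::metric_space) set \<Rightarrow> ('a \<times> 'g \<Rightarrow> 'a) \<Rightarrow>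
     real set \<Rightarrow> (real \<Rightarrow> 'a) \<Rightarrow> (real \<Rightarrow> 'g) \<Rightarrow> bool" where
  "trajectory domf f I x \<sigma> \<longleftrightarrow>
     switching_signal \<sigma> \<and> (\<forall>t\<in>I. (x t, \<sigma> t) \<in> domf) \<and>
     ode_solution (\<lambda>t \<xi>. f (\<xi>, \<sigma> t)) I x"

definition precompact_relative :: "real set \<Rightarrow> (real \<Rightarrow> 'a::topological_space) \<Rightarrow> 'a set \<Rightarrow> bool" where
  "precompact_relative I x U \<longleftrightarrow> (\<exists>B. compact B \<and> B \<subseteq> U \<and> (\<forall>t\<in>I. x t \<in> B))"

text \<open>
  Convergence to a set. As \<open>infdist \<xi> {} = 0\<close> in the library, whereas the infimum over the empty set
  is \<open>+\<infinity>\<close>, the empty set has to be excluded explicitly.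
\<close>

definition converges_to_set :: "(real \<Rightarrow> 'a::metric_space) \<Rightarrow> 'a set \<Rightarrow> bool" where
  "converges_to_set x M \<longleftrightarrow> M \<noteq> {} \<and> ((\<lambda>t. infdist (x t) M) \<longlongrightarrow> 0) at_top"

subsection \<open>Sections, equilibria and the class of Lyapunov-like functions\<close>

text \<open>\<open>slice domf \<gamma>\<close> is \<open>\<chi>\<^sub>\<gamma>\<close>, and \<open>slice domV \<gamma>\<close> is \<open>\<D>\<^sub>\<gamma>\<close>.\<close>

definition slice :: "('a \<times> 'g) set \<Rightarrow> 'g \<Rightarrow> 'a set" where
  "slice D \<gamma> = {\<xi>. (\<xi>, \<gamma>) \<in> D}"

definition equilibria :: "('a::zero \<times> 'g) set \<Rightarrow> ('a \<times> 'g \<Rightarrow> 'a) \<Rightarrow> 'g \<Rightarrow> 'a set" where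
  "equilibria domf f \<gamma> = {\<xi> \<in> slice domf \<gamma>. f (\<xi>, \<gamma>) = 0}"

text \<open>\<open>state_dom domV\<close> is \<open>\<O> = \<pi>\<^sub>1(dom V)\<close>, and \<open>state_dom_at domf domV \<gamma>\<close> is \<open>\<O>\<^sub>\<gamma> = \<O> \<inter> \<chi>\<^sub>\<gamma>\<close>.\<close>

definition state_dom :: "('a \<times> 'g) set \<Rightarrow> 'a set" where
  "state_dom domV = fst ` domV"

definition state_dom_at :: "('a \<times> 'g) set \<Rightarrow> ('a \<times> 'g) set \<Rightarrow> 'g \<Rightarrow> 'a set" where
  "state_dom_at domf domV \<gamma> = state_dom domV \<inter> slice domf \<gamma>"

definition level_set :: "('a \<times> 'g) set \<Rightarrow> ('a \<times> 'g \<Rightarrow> real) \<Rightarrow> 'g \<Rightarrow> real \<Rightarrow> 'a set" where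
  "level_set domV V \<gamma> c = {\<xi> \<in> slice domV \<gamma>. V (\<xi>, \<gamma>) = c}"

definition class_V ::
    "('a::real_normed_vector \<times> 'g) set \<Rightarrow> ('a \<times> 'g) set \<Rightarrow> ('a \<times> 'g \<Rightarrow> real) \<Rightarrow> bool" where
  "class_V domf domV V \<longleftrightarrow>
     (\<forall>\<gamma>. open (slice domV \<gamma>)) \<and>
     (\<forall>\<gamma>. state_dom_at domf domV \<gamma> \<subseteq> slice domV \<gamma>) \<and>
     (\<forall>\<gamma>. \<forall>\<xi>\<in>state_dom_at domf domV \<gamma>. (\<lambda>\<eta>. V (\<eta>, \<gamma>)) differentiable (at \<xi>))"

text \<open>\<open>\<nabla>V\<^sub>\<gamma>(\<xi>) f\<^sub>\<gamma>(\<xi>)\<close> is the derivative of \<open>V\<^sub>\<gamma>\<close> at \<open>\<xi>\<close> applied to the vector \<open>f\<^sub>\<gamma>(\<xi>)\<close>.\<close>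

definition decay_inequality ::
    "('a::real_normed_vector \<times> 'g) set \<Rightarrow> ('a \<times> 'g \<Rightarrow> 'a) \<Rightarrow>
     ('a \<times> 'g) set \<Rightarrow> ('a \<times> 'g \<Rightarrow> real) \<Rightarrow> ('g \<Rightarrow> 'a \<Rightarrow> real) \<Rightarrow> bool" where
  "decay_inequality domf f domV V W \<longleftrightarrow>
     (\<forall>\<gamma>. \<forall>\<xi>\<in>state_dom_at domf domV \<gamma>.
        - frechet_derivative (\<lambda>\<eta>. V (\<eta>, \<gamma>)) (at \<xi>) (f (\<xi>, \<gamma>)) \<ge> W \<gamma> \<xi> \<and> W \<gamma> \<xi> \<ge> 0)"

subsection \<open>Observability-like sets\<close>

definition obs_forward_upto ::
    "'a set \<Rightarrow> ('a \<Rightarrow> 'a) \<Rightarrow> ('a::real_normed_vector \<Rightarrow> real) \<Rightarrow> real \<Rightarrow> 'a set" where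
  "obs_forward_upto X g h \<tau> = {\<xi> \<in> X. \<exists>\<phi>. ode_solution (\<lambda>_. g) {0..\<tau>} \<phi> \<and>
     \<phi> ` {0..\<tau>} \<subseteq> X \<and> \<phi> 0 = \<xi> \<and> (\<forall>t\<in>{0..\<tau>}. h (\<phi> t) = 0)}"

definition obs_backward_upto ::
    "'a set \<Rightarrow> ('a \<Rightarrow> 'a) \<Rightarrow> ('a::real_normed_vector \<Rightarrow> real) \<Rightarrow> real \<Rightarrow> 'a set" where
  "obs_backward_upto X g h \<tau> = {\<xi> \<in> X. \<exists>\<phi>. ode_solution (\<lambda>_. g) {-\<tau>..0} \<phi> \<and>
     \<phi> ` {-\<tau>..0} \<subseteq> X \<and> \<phi> 0 = \<xi> \<and> (\<forall>t\<in>{-\<tau>..0}. h (\<phi> t) = 0)}"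

definition obs_forward ::
    "'a set \<Rightarrow> ('a \<Rightarrow> 'a) \<Rightarrow> ('a::real_normed_vector \<Rightarrow> real) \<Rightarrow> 'a set" where
  "obs_forward X g h = (\<Union>\<tau>\<in>{0<..}. obs_forward_upto X g h \<tau>)"

definition obs_backward ::
    "'a set \<Rightarrow> ('a \<Rightarrow> 'a) \<Rightarrow> ('a::real_normed_vector \<Rightarrow> real) \<Rightarrow> 'a set" where
  "obs_backward X g h = (\<Union>\<tau>\<in>{0<..}. obs_backward_upto X g h \<tau>)"

text \<open>The standing observability hypothesis; the side may depend on \<open>\<gamma>\<close>.\<close>

definition observability_condition ::
    "('a::real_normed_vector \<times> 'g) set \<Rightarrow> ('a \<times> 'g \<Rightarrow> 'a) \<Rightarrow>
     ('a \<times> 'g) set \<Rightarrow> ('g \<Rightarrow> 'a \<Rightarrow> real) \<Rightarrow> bool" where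
  "observability_condition domf f domV W \<longleftrightarrow>
     (\<forall>\<gamma>. obs_backward (state_dom_at domf domV \<gamma>) (\<lambda>\<xi>. f (\<xi>, \<gamma>)) (W \<gamma>)
            = equilibria domf f \<gamma> \<inter> state_dom_at domf domV \<gamma> \<or>
          obs_forward (state_dom_at domf domV \<gamma>) (\<lambda>\<xi>. f (\<xi>, \<gamma>)) (W \<gamma>)
            = equilibria domf f \<gamma> \<inter> state_dom_at domf domV \<gamma>)"

end

theory Submission
  imports Defs "HOL-Complex_Analysis.Great_Picard"
begin

text \<open>
  Dwell time confines every large time \<open>t\<close> to a window of fixed length on which \<open>\<sigma>\<close> is constant, say
  equal to \<open>\<gamma>\<close>. By Arzela-Ascoli the curve, restricted to such windows moving to infinity, subconverges
  uniformly to a solution \<open>y\<close> of \<open>y' = f\<^sub>\<gamma>(y)\<close> along which \<open>V\<^sub>\<gamma>\<close> is constant, so that \<open>W\<^sub>\<gamma>\<close>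
  vanishes along \<open>y\<close>. Each interior point of the window then lies in both observability-like sets,
  whence \<open>f\<^sub>\<gamma>(y) = 0\<close>. Consequently \<open>f(x(t), \<sigma>(t))\<close> tends to \<open>0\<close>, and \<open>x\<close> moves arbitrarily little on
  late intervals of bounded length. As every mode is visited on each interval of length \<open>T\<close>, each
  limit point of \<open>x\<close> is an equilibrium of all modes simultaneously.
\<close>

subsection \<open>Absolutely continuous curves\<close>

text \<open>
  The gauge keeps the intervals whose tags are exceptional inside an open set of small measure around
  the null set of exceptional points; absolute continuity bounds their contribution.
\<close>

lemma absolutely_continuous_has_integral_vector_derivative:
  fixes x :: "real \<Rightarrow> 'a::real_normed_vector"
  assumes ab: "a \<le> b"
    and ac: "absolutely_continuous_on_interval a b x"
    and der: "AE t in lebesgue. t \<in> {a..b} \<longrightarrow> (x has_vector_derivative g t) (at t within {a..b})"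
  shows "(g has_integral x b - x a) {a..b}"
proof -
  define N where "N = {t\<in>{a..b}. \<not> (x has_vector_derivative g t) (at t within {a..b})}"
  \<comment> \<open>The hypothesis only provides a null set containing \<open>N\<close>;
    completeness of Lebesgue measure makes \<open>N\<close> itself null.\<close>
  have N: "N \<in> null_sets lebesgue"
  proof -
    obtain N' where N': "N' \<in> null_sets lebesgue" "N \<subseteq> N'"
      using der by (auto simp: eventually_ae_filter N_def subset_eq)
    then show ?thesis
      by (simp add: completion.complete2 null_sets_completion_subset)
  qed
  then have neg: "negligible N"
    by (simp add: negligible_iff_null_sets)
  \<comment> \<open>\<open>g\<close> is arbitrary on \<open>N\<close>; the value 0 makes exceptional
    tags contribute nothing to the Riemann sum. The change is undone at the end, \<open>N\<close>
    being negligible.\<close>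
  define g0 where "g0 t = (if t \<in> N then 0 else g t)" for t
  have "(g0 has_integral x b - x a) {a..b}"
    unfolding has_integral_factor_content_real
  proof (intro allI impI)
    fix e :: real assume e: "0 < e"
    show "\<exists>d. gauge d \<and> (\<forall>p. p tagged_division_of {a..b} \<and> d fine p \<longrightarrow>
      norm ((\<Sum>(t, K)\<in>p. measure lborel K *\<^sub>R g0 t) - (x b - x a)) \<le> e * measure lborel {a..b})"
    \<comment> \<open>The degenerate interval is separated because absolute continuity is applied
      below with the tolerance \<open>e2 * (b - a)\<close>, which must be positive.\<close>
    proof (cases "a = b")
      case True
      have "norm ((\<Sum>(t, K)\<in>p. measure lborel K *\<^sub>R g0 t) - (x b - x a)) \<le> e * measure lborel {a..b}"
        if "p tagged_division_of {a..b}" for p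
      proof -
        have "measure lborel K *\<^sub>R g0 t = 0" if "(t, K) \<in> p" for t K
        proof -
          obtain u v where uv: "K = cbox u v" "K \<subseteq> {a..b}" "t \<in> K"
            using \<open>p tagged_division_of {a..b}\<close> \<open>(t, K) \<in> p\<close> by (metis tagged_division_ofD(2,3,4))
          then have "u \<in> {a..b}" "v \<in> {a..b}" by auto
          then show ?thesis using True uv(1) by simp
        qed
        then have "(\<Sum>(t, K)\<in>p. measure lborel K *\<^sub>R g0 t) = 0"
          by (intro sum.neutral) auto
        then show ?thesis using True by simp
      qed
      then show ?thesis by (intro exI[of _ "\<lambda>t. ball t 1"]) auto
    next
      case False
      then have "a < b" using ab by simp
      \<comment> \<open>One half of the error is for the differentiability points, the other for the
        exceptional tags.\<close>
      define e2 where "e2 = e / 2"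
      have e2: "0 < e2" using e by (simp add: e2_def)
      obtain \<delta> where \<delta>: "0 < \<delta>" and ac': "\<And>d. d division_of \<Union>d \<Longrightarrow> \<Union>d \<subseteq> {a..b} \<Longrightarrow>
          (\<Sum>k\<in>d. Sup k - Inf k) < \<delta> \<Longrightarrow> (\<Sum>k\<in>d. norm (x (Sup k) - x (Inf k))) < e2 * (b - a)"
        using ac[unfolded absolutely_continuous_on_interval_def, rule_format, of "e2 * (b - a)"] e2 \<open>a < b\<close>
        by auto
      obtain U where U: "open U" "N \<subseteq> U" "(U - N) \<in> lmeasurable" "emeasure lebesgue (U - N) < ennreal \<delta>"
        using sets_lebesgue_outer_open[of N \<delta>] N \<delta> by blast
      have "N \<in> lmeasurable"
        using N by (rule fmeasurableI_null_sets)
      have UN: "(U - N) \<union> N = U" using U(2) by blast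
      have Umeas: "U \<in> lmeasurable"
        using fmeasurable.Un[OF U(3) \<open>N \<in> lmeasurable\<close>] by (simp only: UN)
      have "measure lebesgue U = measure lebesgue (U - N)"
        using measure_Un_null_set[OF fmeasurableD[OF U(3)] N] by (simp only: UN)
      also have "\<dots> < \<delta>"
        using U(3,4) by (simp add: emeasure_eq_measure2 ennreal_less_iff)
      finally have Um: "measure lebesgue U < \<delta>" .
      have "\<forall>t. \<exists>d>0. t \<in> {a..b} - N \<longrightarrow>
         (\<forall>y\<in>{a..b}. norm (y-t) < d \<longrightarrow> norm (x y - x t - (y-t) *\<^sub>R g t) \<le> e2 * norm (y-t))"
      proof
        fix t
        show "\<exists>d>0. t \<in> {a..b} - N \<longrightarrow>
         (\<forall>y\<in>{a..b}. norm (y-t) < d \<longrightarrow> norm (x y - x t - (y-t) *\<^sub>R g t) \<le> e2 * norm (y-t))"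
        proof (cases "t \<in> {a..b} - N")
          case True
          then have "(x has_vector_derivative g t) (at t within {a..b})" by (auto simp: N_def)
          then obtain d where "0 < d"
            "\<forall>y\<in>{a..b}. norm (y-t) < d \<longrightarrow> norm (x y - x t - (y-t) *\<^sub>R g t) \<le> e2 * norm (y-t)"
            using e2 unfolding has_vector_derivative_def has_derivative_within_alt by blast
          then show ?thesis by blast
        qed (use zero_less_one in blast)
      qed
      then obtain d where d: "\<And>t. 0 < d t"
        "\<And>t y. \<lbrakk>t \<in> {a..b} - N; y \<in> {a..b}; norm (y-t) < d t\<rbrakk>
                        \<Longrightarrow> norm (x y - x t - (y-t) *\<^sub>R g t) \<le> e2 * norm (y-t)"
        by metis
      define G where "G t = (if t \<in> N then U else ball t (d t))" for t
      have "gauge G"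
        using U(1,2) d(1) by (auto simp: gauge_def G_def)
      moreover have "norm ((\<Sum>(t, K)\<in>p. measure lborel K *\<^sub>R g0 t) - (x b - x a)) \<le> e * measure lborel {a..b}"
        if p: "p tagged_division_of {a..b}" and fine: "G fine p" for p
      proof -
        define q where "q = {(t, K) \<in> p. t \<in> N}"
        have qp: "q \<subseteq> p" by (auto simp: q_def)
        have fin: "finite p" "finite q"
          using tagged_division_of_finite[OF p] finite_subset[OF qp] by simp_all
        have K: "\<exists>u v. K = {u..v} \<and> u \<le> v \<and> u \<in> {a..b} \<and> v \<in> {a..b} \<and> t \<in> {u..v}" if tK: "(t, K) \<in> p" for t K
        proof -
          obtain u v where "K = cbox u v"
            using tagged_division_ofD(4)[OF p tK] by blast
          with tagged_division_ofD(2,3)[OF p tK] show ?thesis by (intro exI[of _ u] exI[of _ v]) auto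
        qed
        \<comment> \<open>Straddle estimate: the tag lies between the two endpoints, so the
          linearisation errors towards both of them add up to at most \<open>e2\<close> times the
          length.\<close>
        have good: "norm (\<Sum>(t, K) \<in> p - q. measure lborel K *\<^sub>R g0 t - (x (Sup K) - x (Inf K)))
            \<le> (\<Sum>(t, K) \<in> p - q. e2 * (Sup K - Inf K))"
        proof (rule sum_norm_le, safe)
          fix t K assume tK: "(t, K) \<in> p" "(t, K) \<notin> q"
          then have tN: "t \<notin> N" by (auto simp: q_def)
          obtain u v where k: "K = {u..v}" "u \<le> v" "u \<in> {a..b}" "v \<in> {a..b}" "t \<in> {u..v}"
            using K[OF tK(1)] by blast
          have "K \<subseteq> ball t (d t)"
            using fineD[OF fine tK(1)] tN by (simp add: G_def)
          moreover have "u \<in> K" "v \<in> K" using k by auto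
          ultimately have "u \<in> ball t (d t)" "v \<in> ball t (d t)" by blast+
          then have uv: "norm (u - t) < d t" "norm (v - t) < d t"
            by (simp_all add: dist_real_def)
          have t: "t \<in> {a..b} - N" using k tN by auto
          have "norm ((v - u) *\<^sub>R g t - (x v - x u))
              = norm ((x u - x t - (u - t) *\<^sub>R g t) - (x v - x t - (v - t) *\<^sub>R g t))"
            by (auto simp: algebra_simps)
          also have "\<dots> \<le> norm (x u - x t - (u - t) *\<^sub>R g t) + norm (x v - x t - (v - t) *\<^sub>R g t)"
            by (rule norm_triangle_ineq4)
          also have "\<dots> \<le> e2 * norm (u - t) + e2 * norm (v - t)"
            by (intro add_mono d(2) t k uv)
          also have "\<dots> = e2 * (v - u)"
            using k by (auto simp: algebra_simps)
          finally show "norm (measure lborel K *\<^sub>R g0 t - (x (Sup K) - x (Inf K))) \<le> e2 * (Sup K - Inf K)"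
            using k tN by (simp add: g0_def)
        qed
        have qpart: "q tagged_partial_division_of {a..b}"
          using tagged_partial_division_subset[OF _ qp] p unfolding tagged_division_of_def by simp
        have qdiv: "(snd ` q) division_of \<Union>(snd ` q)"
          using partial_division_of_tagged_division[OF qpart] .
        have ne: "K \<noteq> {}" if "(t, K) \<in> q" for t K
          using K[of t K] subsetD[OF qp that] by auto
        \<comment> \<open>Distinct tagged pairs may share an interval only if it is degenerate,
          where \<open>h\<close> vanishes. The variant \<open>h'\<close> is forced to be 0 at the
          empty set as well, since \<open>Sup\<close> and \<open>Inf\<close> are uncontrolled
          there.\<close>
        have qsum: "(\<Sum>(t, K)\<in>q. h K) = (\<Sum>K\<in>snd ` q. h K)"
          if h: "\<And>u. h {u..u} = 0" for h :: "real set \<Rightarrow> real"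
        proof -
          define h' where "h' K = (if K = {} then 0 else h K)" for K
          have "(\<Sum>(t, K)\<in>q. h K) = (\<Sum>(t, K)\<in>q. h' K)"
            using ne by (intro sum.cong) (auto simp: h'_def)
          also have "\<dots> = (\<Sum>K\<in>snd ` q. h' K)"
          proof (rule sum.over_tagged_division_lemma[OF tagged_partial_division_of_Union_self[OF qpart]])
            fix u v :: real assume "box u v = {}"
            then have "v \<le> u" by simp
            then show "h' (cbox u v) = 0" using h by (cases "u = v") (auto simp: h'_def)
          qed
          also have "\<dots> = (\<Sum>K\<in>snd ` q. h K)"
            using ne by (intro sum.cong) (auto simp: h'_def)
          finally show ?thesis .
        qed
        have "(\<Sum>K\<in>snd ` q. Sup K - Inf K) = (\<Sum>K\<in>snd ` q. measure lborel K)"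
        proof (rule sum.cong)
          fix k assume "k \<in> snd ` q"
          then obtain t where "(t, k) \<in> p" using qp by auto
          with K[of t k] show "Sup k - Inf k = measure lborel k" by auto
        qed simp
        also have "\<dots> = measure lebesgue (\<Union>(snd ` q))"
          unfolding content_division[OF qdiv, symmetric] using division_ofD(4)[OF qdiv]
          by (intro sum.cong refl) (metis borel_closed closed_cbox measure_completion sets_lborel)
        also have "\<dots> \<le> measure lebesgue U"
        proof (rule measure_mono_fmeasurable)
          show "\<Union>(snd ` q) \<subseteq> U"
          proof
            fix u assume "u \<in> \<Union>(snd ` q)"
            then obtain t k where "(t, k) \<in> p" "t \<in> N" "u \<in> k" by (auto simp: q_def)
            then show "u \<in> U" using fineD[OF fine, of t k] by (auto simp: G_def)
          qed
          show "\<Union>(snd ` q) \<in> sets lebesgue"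
            using qdiv by (meson fmeasurableD lmeasurable_division)
        qed (rule Umeas)
        also have "\<dots> < \<delta>" by (rule Um)
        finally have small: "(\<Sum>K\<in>snd ` q. Sup K - Inf K) < \<delta>" .
        have "\<Union>(snd ` q) \<subseteq> {a..b}"
        proof
          fix u assume "u \<in> \<Union>(snd ` q)"
          then obtain t k where "(t, k) \<in> p" "u \<in> k" using qp by auto
          with K[of t k] show "u \<in> {a..b}" by auto
        qed
        then have bad': "(\<Sum>K\<in>snd ` q. norm (x (Sup K) - x (Inf K))) < e2 * (b - a)"
          using ac' qdiv small by blast
        have "norm (\<Sum>(t, K) \<in> q. measure lborel K *\<^sub>R g0 t - (x (Sup K) - x (Inf K)))
            \<le> (\<Sum>(t, K) \<in> q. norm (x (Sup K) - x (Inf K)))"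
          by (rule sum_norm_le) (auto simp: q_def g0_def norm_minus_commute)
        also have "\<dots> = (\<Sum>K\<in>snd ` q. norm (x (Sup K) - x (Inf K)))"
          by (rule qsum) simp
        finally have bad: "norm (\<Sum>(t, K) \<in> q. measure lborel K *\<^sub>R g0 t - (x (Sup K) - x (Inf K))) \<le> e2 * (b - a)"
          using bad' by linarith
        have "(\<Sum>(t, K) \<in> p - q. e2 * (Sup K - Inf K)) \<le> (\<Sum>(t, K) \<in> p. e2 * (Sup K - Inf K))"
        proof (rule sum_mono2)
          fix z assume "z \<in> p - (p - q)"
          moreover obtain t k where "z = (t, k)" by force
          ultimately show "0 \<le> (case z of (t, K) \<Rightarrow> e2 * (Sup K - Inf K))"
            using K[of t k] e2 by auto
        qed (use fin in auto)
        also have "\<dots> = e2 * (b - a)"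
          using additive_tagged_division_1[OF ab p, of "\<lambda>t. t"]
          by (simp add: split_def flip: sum_distrib_left)
        finally have good': "norm (\<Sum>(t, K) \<in> p - q. measure lborel K *\<^sub>R g0 t - (x (Sup K) - x (Inf K))) \<le> e2 * (b - a)"
          using good by linarith
        \<comment> \<open>The increments of \<open>x\<close> over the intervals of the division
          telescope to \<open>x b - x a\<close>.\<close>
        have "norm ((\<Sum>(t, K)\<in>p. measure lborel K *\<^sub>R g0 t) - (x b - x a))
            = norm (\<Sum>(t, K) \<in> p. measure lborel K *\<^sub>R g0 t - (x (Sup K) - x (Inf K)))"
          using additive_tagged_division_1[OF ab p, of x] by (simp add: split_def sum_subtractf)
        also have "\<dots> = norm ((\<Sum>(t, K) \<in> p - q. measure lborel K *\<^sub>R g0 t - (x (Sup K) - x (Inf K)))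
            + (\<Sum>(t, K) \<in> q. measure lborel K *\<^sub>R g0 t - (x (Sup K) - x (Inf K))))"
          using sum.subset_diff[OF qp fin(1)] by (rule arg_cong)
        also have "\<dots> \<le> e2 * (b - a) + e2 * (b - a)"
          by (rule order_trans[OF norm_triangle_ineq add_mono[OF good' bad]])
        finally show ?thesis
          using ab by (simp add: e2_def)
      qed
      ultimately show ?thesis by (intro exI[of _ G] conjI allI impI) simp_all
    qed
  qed
  then show ?thesis
    by (rule has_integral_spike[OF neg, rotated]) (auto simp: g0_def)
qed

section \<open>Classical solutions as Caratheodory solutions\<close>

lemma lipschitz_imp_absolutely_continuous_on_interval:
  fixes x :: "real \<Rightarrow> 'a::real_normed_vector"
  assumes lip: "\<And>s t. s \<in> {a..b} \<Longrightarrow> t \<in> {a..b} \<Longrightarrow> norm (x t - x s) \<le> M * \<bar>t - s\<bar>"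
  shows "absolutely_continuous_on_interval a b x"
  unfolding absolutely_continuous_on_interval_def
proof (intro allI impI)
  fix \<epsilon> :: real assume \<epsilon>: "0 < \<epsilon>"
  \<comment> \<open>The assumption does not force \<open>M\<close> to be positive, whereas
    \<open>\<epsilon> / L\<close> needs a positive denominator.\<close>
  define L where "L = \<bar>M\<bar> + 1"
  have L: "0 < L" "M \<le> L" by (auto simp: L_def)
  have "(\<Sum>k\<in>d. norm (x (Sup k) - x (Inf k))) < \<epsilon>"
    if d: "d division_of \<Union>d" "\<Union>d \<subseteq> {a..b}" "(\<Sum>k\<in>d. Sup k - Inf k) < \<epsilon> / L" for d
  proof -
    have "(\<Sum>k\<in>d. norm (x (Sup k) - x (Inf k))) \<le> (\<Sum>k\<in>d. L * (Sup k - Inf k))"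
    proof (rule sum_mono)
      fix k assume k: "k \<in> d"
      then obtain u v where uv: "k = cbox u v" "k \<noteq> {}" "k \<subseteq> {a..b}"
        using d(1,2) division_ofD(3,4) by (metis Sup_le_iff)
      then have "norm (x v - x u) \<le> M * \<bar>v - u\<bar>"
        by (intro lip) auto
      also have "\<dots> \<le> L * \<bar>v - u\<bar>" using L by (intro mult_right_mono) auto
      finally show "norm (x (Sup k) - x (Inf k)) \<le> L * (Sup k - Inf k)"
        using uv by auto
    qed
    also have "\<dots> < \<epsilon>"
      using d(3) L by (simp only: flip: sum_distrib_left) (simp add: pos_less_divide_eq mult.commute)
    finally show ?thesis .
  qed
  then show "\<exists>\<delta>>0. \<forall>d. d division_of \<Union>d \<and> \<Union>d \<subseteq> {a..b} \<and> (\<Sum>k\<in>d. Sup k - Inf k) < \<delta> \<longrightarrow>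
        (\<Sum>k\<in>d. norm (x (Sup k) - x (Inf k))) < \<epsilon>"
    using \<epsilon> L by (intro exI[of _ "\<epsilon> / L"]) auto
qed

text \<open>A velocity that is continuous on a compact interval is bounded, so the mean value
  inequality makes the curve Lipschitz, hence absolutely continuous. This turns limit curves into
  solutions in the sense of the observability-like sets.\<close>

lemma ode_solution_of_continuous_derivative:
  fixes x :: "real \<Rightarrow> 'a::real_normed_vector"
  assumes ab: "a \<le> b"
    and der: "\<And>t. t \<in> {a..b} \<Longrightarrow> (x has_vector_derivative F t (x t)) (at t within {a..b})"
    and cont: "continuous_on {a..b} (\<lambda>t. F t (x t))"
  shows "ode_solution F {a..b} x"
proof -
  have "bounded ((\<lambda>t. F t (x t)) ` {a..b})"
    using compact_continuous_image[OF cont] compact_imp_bounded by blast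
  then obtain M where M: "\<And>t. t \<in> {a..b} \<Longrightarrow> norm (F t (x t)) \<le> M"
    unfolding bounded_iff by blast
  have "norm (x t - x s) \<le> M * \<bar>t - s\<bar>" if "s \<in> {a..b}" "t \<in> {a..b}" for s t
  proof -
    have "norm (x t - x s) \<le> M * norm (t - s)"
    proof (rule differentiable_bound[of "{a..b}" x "\<lambda>t h. h *\<^sub>R F t (x t)"])
      show "(x has_derivative (\<lambda>h. h *\<^sub>R F t (x t))) (at t within {a..b})" if "t \<in> {a..b}" for t
        using der[OF that] by (simp add: has_vector_derivative_def)
      show "onorm (\<lambda>h. h *\<^sub>R F t (x t)) \<le> M" if "t \<in> {a..b}" for t
        using M[OF that] by (intro onorm_le) (simp add: mult.commute[of M] mult_left_mono)
    qed (use that in auto)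
    then show ?thesis by simp
  qed
  then have "locally_absolutely_continuous_on {a..b} x"
    unfolding locally_absolutely_continuous_on_def
    by (intro allI impI lipschitz_imp_absolutely_continuous_on_interval[of _ _ _ M]) (meson subsetD)
  then show ?thesis
    using der ab by (auto simp: ode_solution_def is_interval_cc)
qed

subsection \<open>Limit points at infinity\<close>

lemma frequently_at_top_real: "(\<exists>\<^sub>F t::real in at_top. P t) \<longleftrightarrow> (\<forall>S. \<exists>t\<ge>S. P t)"
  by (simp add: frequently_def eventually_at_top_linorder)

text \<open>The bound \<open>real k \<le> t k\<close> gives more than divergence: every term is
  nonnegative, which is where \<open>x\<close> is known to stay in the compact set.\<close>

lemma frequently_at_top_sequence:
  fixes P :: "real \<Rightarrow> bool"
  assumes "\<exists>\<^sub>F t in at_top. P t"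
  shows "\<exists>t::nat \<Rightarrow> real. (\<forall>k. real k \<le> t k) \<and> (\<forall>k. P (t k)) \<and> filterlim t at_top sequentially"
proof -
  have "\<forall>k. \<exists>t\<ge>real k. P t"
    using assms by (simp add: frequently_at_top_real)
  then obtain t where t: "\<And>k. real k \<le> t k" "\<And>k. P (t k)" by metis
  then have "filterlim t at_top sequentially"
    by (intro filterlim_at_top_mono[OF filterlim_real_sequentially]) auto
  with t show ?thesis by blast
qed

text \<open>The omega-limit set of the curve, described by sequences of times.\<close>

definition omega_limits :: "(real \<Rightarrow> 'a::topological_space) \<Rightarrow> 'a set" where
  "omega_limits x = {\<xi>. \<exists>t::nat \<Rightarrow> real. filterlim t at_top sequentially \<and> (\<lambda>k. x (t k)) \<longlonglongrightarrow> \<xi>}"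

text \<open>The form in which compactness enters the arguments by contradiction: a closed condition
  on the state that recurs at arbitrarily late times passes to some limit point.\<close>

lemma frequently_omega_limit:
  fixes x :: "real \<Rightarrow> 'a::metric_space"
  assumes B: "compact B" "\<And>t. 0 \<le> t \<Longrightarrow> x t \<in> B"
    and freq: "\<exists>\<^sub>F t in at_top. P t"
  shows "\<exists>\<xi>\<in>omega_limits x. \<exists>t::nat \<Rightarrow> real. (\<forall>k. P (t k)) \<and> (\<lambda>k. x (t k)) \<longlonglongrightarrow> \<xi>"
proof -
  obtain t :: "nat \<Rightarrow> real" where t: "\<And>k. real k \<le> t k" "\<And>k. P (t k)" "filterlim t at_top sequentially"
    using frequently_at_top_sequence[OF freq] by blast
  have "\<forall>k. x (t k) \<in> B"
    using B(2) t(1) by (meson of_nat_0_le_iff order_trans)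
  then obtain \<xi> r where r: "strict_mono r" "((\<lambda>k. x (t k)) \<circ> r) \<longlonglongrightarrow> \<xi>"
    using B(1) by (auto elim!: seq_compactE simp: compact_eq_seq_compact_metric)
  have lim: "filterlim (\<lambda>k. t (r k)) at_top sequentially"
    using filterlim_compose[OF t(3) filterlim_subseq[OF r(1)]] .
  have "(\<lambda>k. x (t (r k))) \<longlonglongrightarrow> \<xi>"
    using r(2) by (simp add: o_def)
  with lim have "\<xi> \<in> omega_limits x"
    unfolding omega_limits_def by blast
  with \<open>(\<lambda>k. x (t (r k))) \<longlonglongrightarrow> \<xi>\<close> show ?thesis
    using t(2) by (intro bexI[of _ \<xi>] exI[of _ "\<lambda>k. t (r k)"]) simp_all
qed

text \<open>Otherwise the curve is at distance at least \<open>e\<close> from \<open>M\<close> at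
  arbitrarily late times, and compactness yields a limit point that is still at that distance,
  although it belongs to \<open>M\<close>.\<close>

lemma converges_to_set_if_omega_limits_subset:
  fixes x :: "real \<Rightarrow> 'a::metric_space"
  assumes B: "compact B" "\<And>t. 0 \<le> t \<Longrightarrow> x t \<in> B"
    and M: "omega_limits x \<subseteq> M"
  shows "converges_to_set x M"
  unfolding converges_to_set_def
proof
  \<comment> \<open>The trivial property recurs, so a limit point exists; this gives
    \<open>M \<noteq> {}\<close>, which is part of convergence to a set.\<close>
  have "\<exists>\<^sub>F t::real in at_top. t \<in> UNIV"
    unfolding frequently_at_top_real
  proof
    show "\<exists>t\<ge>S. t \<in> UNIV" for S :: real
      by (intro exI[of _ S]) simp
  qed
  then obtain \<xi> where "\<xi> \<in> omega_limits x"
    using frequently_omega_limit[where x = x and P = "\<lambda>t. t \<in> UNIV", OF B] by blast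
  then show "M \<noteq> {}" using M by blast
  show "((\<lambda>t. infdist (x t) M) \<longlongrightarrow> 0) at_top"
  proof (rule ccontr)
    assume "\<not> ?thesis"
    then obtain e where e: "0 < e" "\<exists>\<^sub>F t in at_top. e \<le> infdist (x t) M"
      by (auto simp: tendsto_iff frequently_def not_le infdist_nonneg)
    obtain \<xi> t where t: "\<xi> \<in> omega_limits x" "\<And>k::nat. e \<le> infdist (x (t k)) M" "(\<lambda>k. x (t k)) \<longlonglongrightarrow> \<xi>"
      using frequently_omega_limit[where x = x, OF B e(2)] by blast
    have "(\<lambda>k. infdist (x (t k)) M) \<longlonglongrightarrow> infdist \<xi> M"
      by (intro tendsto_infdist t(3))
    then have "e \<le> infdist \<xi> M"
      using t(2) by (intro tendsto_lowerbound[where F = sequentially]) auto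
    moreover have "infdist \<xi> M = 0"
      using t(1) M by auto
    ultimately show False using e by simp
  qed
qed

text \<open>
  If the curve came close to an isolated limit point without converging to it, it would cross a small
  sphere around it at arbitrarily large times, which produces a further limit point on that sphere.
\<close>

lemma tendsto_if_isolated_omega_limit:
  fixes x :: "real \<Rightarrow> 'a::metric_space"
  assumes cont: "continuous_on {0..} x"
    and B: "compact B" "\<And>t. 0 \<le> t \<Longrightarrow> x t \<in> B"
    and M: "omega_limits x \<subseteq> M"
    and \<xi>: "\<xi> \<in> omega_limits x" "\<xi> isolated_in M"
  shows "(x \<longlongrightarrow> \<xi>) at_top"
proof (rule ccontr)
  assume "\<not> ?thesis"
  then obtain e0 where e0: "0 < e0" "\<exists>\<^sub>F t in at_top. e0 \<le> dist (x t) \<xi>"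
    by (auto simp: tendsto_iff frequently_def not_le)
  obtain r where r: "0 < r" "\<And>y. y \<in> M \<Longrightarrow> dist \<xi> y < r \<Longrightarrow> y = \<xi>"
    using \<xi>(2) by (auto simp: isolated_in_dist_Ex_iff)
  \<comment> \<open>Radius of the sphere: at most \<open>e0\<close>, so that the curve keeps
    returning to its outside or to the sphere itself, and less than \<open>r\<close>, so that the
    sphere contains no point of \<open>M\<close>.\<close>
  define e where "e = min e0 (r / 2)"
  have e: "0 < e" "e < r" "e \<le> e0" using e0 r by (auto simp: e_def)
  obtain s :: "nat \<Rightarrow> real" where s: "filterlim s at_top sequentially" "(\<lambda>k. x (s k)) \<longlonglongrightarrow> \<xi>"
    using \<xi>(1) by (auto simp: omega_limits_def)
  have "\<exists>u\<ge>S. dist (x u) \<xi> = e" for S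
  proof -
    have "\<forall>\<^sub>F k in sequentially. max S 0 \<le> s k"
      using s(1) unfolding filterlim_at_top by blast
    moreover have "\<forall>\<^sub>F k in sequentially. dist (x (s k)) \<xi> < e"
      using s(2) e(1) by (rule tendstoD)
    ultimately have "\<forall>\<^sub>F k in sequentially. max S 0 \<le> s k \<and> dist (x (s k)) \<xi> < e"
      by (rule eventually_conj)
    then obtain k where k: "max S 0 \<le> s k" "dist (x (s k)) \<xi> < e"
      using eventually_happens' sequentially_bot by blast
    obtain t where t: "s k \<le> t" "e0 \<le> dist (x t) \<xi>"
      using e0(2) by (auto simp: frequently_at_top_real)
    have "continuous_on {s k..t} (\<lambda>u. dist (x u) \<xi>)"
      using k(1) by (intro continuous_intros continuous_on_subset[OF cont]) auto
    then obtain u where "s k \<le> u" "dist (x u) \<xi> = e"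
      using IVT'[of "\<lambda>u. dist (x u) \<xi>" "s k" e t] k(2) t e by auto
    then show ?thesis using k(1) by (intro exI[of _ u]) simp
  qed
  then have freq: "\<exists>\<^sub>F u in at_top. dist (x u) \<xi> = e"
    by (simp add: frequently_at_top_real)
  obtain \<eta> t where t: "\<eta> \<in> omega_limits x" "\<And>k::nat. dist (x (t k)) \<xi> = e" "(\<lambda>k. x (t k)) \<longlonglongrightarrow> \<eta>"
    using frequently_omega_limit[where x = x, OF B freq] by blast
  have "(\<lambda>k. dist (x (t k)) \<xi>) \<longlonglongrightarrow> dist \<eta> \<xi>"
    by (intro tendsto_intros t(3))
  then have "dist \<eta> \<xi> = e"
    using t(2) by (simp add: LIMSEQ_const_iff)
  then show False
    using r(2)[of \<eta>] M t(1) e by (auto simp: dist_commute)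
qed

subsection \<open>Dwell time\<close>

text \<open>With dwell time \<open>3 * h\<close> a window of length \<open>h\<close> fits on one
  side of \<open>t\<close>. If no jump occurs in the open interval from \<open>t\<close> to
  \<open>t + 2 * h\<close>, the window starts at \<open>t\<close>. Otherwise a jump \<open>j\<close>
  there excludes jumps strictly between \<open>j - 3 * h\<close> and \<open>j\<close>, a range
  containing \<open>{t - h..t}\<close>.\<close>

lemma dwell_time_constant_interval:
  fixes \<sigma> :: "real \<Rightarrow> 'g::metric_space"
  assumes \<sigma>: "\<sigma> \<in> dwell_time_signals (3 * h)" and h: "0 < h"
  obtains s where "t - h \<le> s" "s \<le> t" "\<And>u. u \<in> {s..s + h} \<Longrightarrow> \<sigma> u = \<sigma> t"
proof (cases "jump_times \<sigma> \<inter> {t<..<t + 2 * h} = {}")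
  case True
  then have "\<sigma> constant_on {t<..<t + 2 * h}"
    using \<sigma> by (simp add: dwell_time_signals_def switching_signal_def piecewise_constant_def)
  then obtain c where c: "\<And>u. u \<in> {t<..<t + 2 * h} \<Longrightarrow> \<sigma> u = c"
    by (auto simp: constant_on_def)
  \<comment> \<open>The jump-free interval is open at \<open>t\<close>; continuity from the right
    carries its constant value over to \<open>t\<close>, which may itself be a jump.\<close>
  have "(\<sigma> \<longlongrightarrow> \<sigma> t) (at_right t)"
    using \<sigma> by (simp add: dwell_time_signals_def switching_signal_def continuous_within)
  moreover have "(\<sigma> \<longlongrightarrow> c) (at_right t)"
  proof (rule tendsto_eventually)
    have "\<forall>\<^sub>F u in at_right t. u \<in> {t<..<t + 2 * h}"
      using h by (intro eventually_at_right_real) simp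
    then show "\<forall>\<^sub>F u in at_right t. \<sigma> u = c"
      by eventually_elim (rule c)
  qed
  ultimately have "\<sigma> t = c"
    by (rule tendsto_unique[OF trivial_limit_at_right_real])
  show thesis
  proof (rule that[of t])
    fix u assume "u \<in> {t..t + h}"
    then show "\<sigma> u = \<sigma> t"
      using c[of u] \<open>\<sigma> t = c\<close> h by (cases "u = t") simp_all
  qed (use h in simp_all)
next
  case False
  then obtain j where j: "j \<in> jump_times \<sigma>" "t < j" "j < t + 2 * h" by auto
  have "jump_times \<sigma> \<inter> {j - 3 * h<..<j} = {}"
  proof (rule equals0I)
    fix i assume i: "i \<in> jump_times \<sigma> \<inter> {j - 3 * h<..<j}"
    moreover have "i \<noteq> j" using i by simp
    ultimately have "3 * h \<le> \<bar>i - j\<bar>"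
      using \<sigma> j(1) unfolding dwell_time_signals_def by blast
    with i show False by simp
  qed
  then have "\<sigma> constant_on {j - 3 * h<..<j}"
    using \<sigma> by (simp add: dwell_time_signals_def switching_signal_def piecewise_constant_def)
  then obtain c where c: "\<And>u. u \<in> {j - 3 * h<..<j} \<Longrightarrow> \<sigma> u = c"
    by (auto simp: constant_on_def)
  show thesis
    using c j h by (intro that[of "t - h"]) auto
qed

subsection \<open>Limits of a trajectory along windows of constant mode\<close>

text \<open>The differential equation is recorded as an integral identity on nonnegative times, the
  form in which it passes to limits.\<close>

locale bounded_trajectory =
  fixes domf :: "('a::euclidean_space \<times> 'g::{finite,metric_space}) set"
    and f :: "'a \<times> 'g \<Rightarrow> 'a"
    and x :: "real \<Rightarrow> 'a" and \<sigma> :: "real \<Rightarrow> 'g" and B :: "'a set"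
  assumes closed_domf: "closed domf"
    and continuous_f: "continuous_on domf f"
    and compact_B: "compact B"
    and x_in_B: "0 \<le> t \<Longrightarrow> x t \<in> B"
    and in_domf: "0 \<le> t \<Longrightarrow> (x t, \<sigma> t) \<in> domf"
    and velocity_integral: "0 \<le> a \<Longrightarrow> a \<le> b \<Longrightarrow> ((\<lambda>t. f (x t, \<sigma> t)) has_integral x b - x a) {a..b}"
begin

lemma closed_slice: "closed (slice domf \<gamma>)"
proof -
  have "slice domf \<gamma> = (\<lambda>\<xi>. (\<xi>, \<gamma>)) -` domf" by (auto simp: slice_def)
  then show ?thesis
    using closed_domf by (simp add: continuous_closed_vimage continuous_intros)
qed

lemma compact_slice: "compact (B \<inter> slice domf \<gamma>)"
  using compact_B closed_slice by (rule compact_Int_closed)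

lemma continuous_on_slice: "continuous_on (slice domf \<gamma>) (\<lambda>\<xi>. f (\<xi>, \<gamma>))"
  by (rule continuous_on_compose2[OF continuous_f]) (auto simp: slice_def intro!: continuous_intros)

lemma displacement_le:
  assumes "0 \<le> a" "a \<le> b" "0 \<le> M" "\<And>t. t \<in> {a..b} \<Longrightarrow> norm (f (x t, \<sigma> t)) \<le> M"
  shows "norm (x b - x a) \<le> M * (b - a)"
  using has_integral_bound[of M "\<lambda>t. f (x t, \<sigma> t)" "x b - x a" a b] velocity_integral[of a b] assms
  by simp

text \<open>Finiteness of the mode set makes the part of \<open>domf\<close> over \<open>B\<close>
  compact.\<close>

lemma bounded_velocity:
  obtains M where "0 < M" "\<And>t. 0 \<le> t \<Longrightarrow> norm (f (x t, \<sigma> t)) \<le> M"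
proof -
  have "compact (domf \<inter> (B \<times> UNIV))"
    by (intro closed_Int_compact closed_domf compact_Times compact_B finite_imp_compact finite)
  then have "bounded (f ` (domf \<inter> (B \<times> UNIV)))"
    by (intro compact_imp_bounded compact_continuous_image continuous_on_subset[OF continuous_f]) auto
  then obtain M where "0 < M" "\<forall>y\<in>f ` (domf \<inter> (B \<times> UNIV)). norm y \<le> M"
    unfolding bounded_pos by blast
  then show thesis
    using that x_in_B in_domf by auto
qed

lemma lipschitz_x:
  obtains M where "0 < M" "\<And>s t. 0 \<le> s \<Longrightarrow> 0 \<le> t \<Longrightarrow> norm (x t - x s) \<le> M * \<bar>t - s\<bar>"
proof -
  obtain M where M: "0 < M" "\<And>t. 0 \<le> t \<Longrightarrow> norm (f (x t, \<sigma> t)) \<le> M"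
    using bounded_velocity by blast
  have *: "norm (x t - x s) \<le> M * (t - s)" if "0 \<le> s" "s \<le> t" for s t
    using that M by (intro displacement_le) auto
  have "norm (x t - x s) \<le> M * \<bar>t - s\<bar>" if "0 \<le> s" "0 \<le> t" for s t
    using *[of s t] *[of t s] that by (cases "s \<le> t") (auto simp: norm_minus_commute)
  with M(1) show thesis by (rule that)
qed

lemma continuous_on_x: "continuous_on {0..} x"
proof -
  obtain M where M: "0 < M" "\<And>s t. 0 \<le> s \<Longrightarrow> 0 \<le> t \<Longrightarrow> norm (x t - x s) \<le> M * \<bar>t - s\<bar>"
    using lipschitz_x by blast
  have "M-lipschitz_on {0..} x"
    using M by (intro lipschitz_onI) (auto simp: dist_norm)
  then show ?thesis by (rule lipschitz_on_continuous_on)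
qed

text \<open>The common Lipschitz constant of the shifted curves gives the equicontinuity for
  Arzela-Ascoli. In a fixed mode the velocity is a uniformly continuous function of the state on a
  compact set, so velocities converge uniformly as well and the integral equation survives in the
  limit.\<close>

lemma window_limit:
  assumes s: "\<And>k::nat. 0 \<le> s k" and h: "0 < h"
    and mode: "\<And>k u. u \<in> {s k..s k + h} \<Longrightarrow> \<sigma> u = \<gamma>"
  obtains y r where "strict_mono (r :: nat \<Rightarrow> nat)"
    "uniform_limit {0..h} (\<lambda>k u. x (s (r k) + u)) y sequentially"
    "\<And>u. u \<in> {0..h} \<Longrightarrow> y u \<in> B \<inter> slice domf \<gamma>"
    "\<And>u. u \<in> {0..h} \<Longrightarrow> (y has_vector_derivative f (y u, \<gamma>)) (at u within {0..h})"
proof -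
  have in_slice: "x (s k + u) \<in> B \<inter> slice domf \<gamma>" if "u \<in> {0..h}" for k u
  proof -
    have "0 \<le> s k + u" using s[of k] that by simp
    then show ?thesis
      using x_in_B in_domf[of "s k + u"] mode[of "s k + u" k] that by (simp add: slice_def)
  qed
  obtain M where M: "0 < M" "\<And>s t. 0 \<le> s \<Longrightarrow> 0 \<le> t \<Longrightarrow> norm (x t - x s) \<le> M * \<bar>t - s\<bar>"
    using lipschitz_x by blast
  obtain K where K: "\<And>\<xi>. \<xi> \<in> B \<Longrightarrow> norm \<xi> \<le> K"
    using compact_imp_bounded[OF compact_B] unfolding bounded_iff by blast
  have equi: "\<exists>d>0. \<forall>k v. v \<in> {0..h} \<and> norm (u - v) < d \<longrightarrow> norm (x (s k + u) - x (s k + v)) < e"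
    if u: "u \<in> {0..h}" and e: "0 < e" for u e
  proof (intro exI[of _ "e / M"] conjI allI impI)
    fix k v assume v: "v \<in> {0..h} \<and> norm (u - v) < e / M"
    have "norm (x (s k + u) - x (s k + v)) \<le> M * \<bar>(s k + u) - (s k + v)\<bar>"
      using s[of k] u v by (intro M(2)) auto
    also have "\<dots> < e"
      using v M(1) by (simp add: pos_less_divide_eq mult.commute)
    finally show "norm (x (s k + u) - x (s k + v)) < e" .
  qed (use e M in simp)
  obtain y r where y: "continuous_on {0..h} y" "strict_mono (r :: nat \<Rightarrow> nat)"
    "\<And>e. 0 < e \<Longrightarrow> \<exists>N. \<forall>n u. n \<ge> N \<and> u \<in> {0..h} \<longrightarrow> norm (x (s (r n) + u) - y u) < e"
    using Arzela_Ascoli[of "{0..h}" "\<lambda>k u. x (s k + u)" K] K in_slice equi by blast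
  have ul: "uniform_limit {0..h} (\<lambda>k u. x (s (r k) + u)) y sequentially"
    unfolding uniform_limit_sequentially_iff dist_norm using y(3) by blast
  have y_in: "y u \<in> B \<inter> slice domf \<gamma>" if "u \<in> {0..h}" for u
    by (rule closed_sequentially[OF compact_imp_closed[OF compact_slice], of "\<lambda>k. x (s (r k) + u)"])
      (use in_slice that tendsto_uniform_limitI[OF ul that] in auto)
  define F where "F \<xi> = f (\<xi>, \<gamma>)" for \<xi>
  have contF: "continuous_on (B \<inter> slice domf \<gamma>) F"
    unfolding F_def by (rule continuous_on_subset[OF continuous_on_slice]) auto
  have ulF: "uniform_limit {0..h} (\<lambda>k u. F (x (s (r k) + u))) (\<lambda>u. F (y u)) sequentially"
    by (rule uniform_limit_compose_uniformly_continuous_on[OF ul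
          compact_uniformly_continuous[OF contF compact_slice]])
      (use in_slice compact_imp_closed[OF compact_slice] in auto)
  have contFy: "continuous_on {0..h} (\<lambda>u. F (y u))"
    by (rule continuous_on_compose2[OF contF y(1)]) (use y_in in auto)
  have shift: "((\<lambda>u. F (x (s k + u))) has_integral x (s k + u) - x (s k)) {0..u}"
    if u: "u \<in> {0..h}" for k u
  proof -
    have "((\<lambda>t. f (x t, \<sigma> t)) has_integral x (s k + u) - x (s k)) {s k..s k + u}"
      using u s[of k] by (intro velocity_integral) auto
    then have "((\<lambda>t. F (x t)) has_integral x (s k + u) - x (s k)) {s k..s k + u}"
      by (rule has_integral_eq[rotated]) (use mode[of _ k] u in \<open>auto simp: F_def\<close>)
    then show ?thesis
      using has_integral_shift_Icc_real[of "\<lambda>t. F (x t)" "s k" "x (s k + u) - x (s k)" 0 u]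
      by (simp add: o_def add.commute)
  qed
  have contFx: "continuous_on {0..h} (\<lambda>u. F (x (s k + u)))" for k
  proof (rule continuous_on_compose2[OF contF])
    show "continuous_on {0..h} (\<lambda>u. x (s k + u))"
      by (rule continuous_on_compose2[OF continuous_on_x])
        (use s[of k] in \<open>auto intro!: continuous_intros\<close>)
  qed (use in_slice in auto)
  \<comment> \<open>The limit of the identities \<open>shift\<close>. Its integrand is continuous,
    so differentiation yields the equation for \<open>y\<close>, one-sided at the endpoints.\<close>
  have y_int: "y u = y 0 + integral {0..u} (\<lambda>u. F (y u))" if u: "u \<in> {0..h}" for u
  proof -
    have sub: "{0..u} \<subseteq> {0..h}" using u by auto
    obtain I J where IJ: "\<And>k. ((\<lambda>u. F (x (s (r k) + u))) has_integral I k) {0..u}"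
      "((\<lambda>u. F (y u)) has_integral J) {0..u}" "I \<longlonglongrightarrow> J"
      using uniform_limit_integral[OF uniform_limit_on_subset[OF ulF sub]
          continuous_on_subset[OF contFx sub] sequentially_bot] by blast
    have "I k = x (s (r k) + u) - x (s (r k) + 0)" for k
      using has_integral_unique[OF IJ(1) shift[OF u]] by simp
    moreover have "(\<lambda>k. x (s (r k) + u) - x (s (r k) + 0)) \<longlonglongrightarrow> y u - y 0"
      by (intro tendsto_diff tendsto_uniform_limitI[OF ul]) (use u h in auto)
    ultimately have "I \<longlonglongrightarrow> y u - y 0"
      by presburger
    then have "J = y u - y 0"
      using IJ(3) LIMSEQ_unique by blast
    then show ?thesis
      using IJ(2) by (simp add: integral_unique)
  qed
  have "(y has_vector_derivative f (y u, \<gamma>)) (at u within {0..h})" if u: "u \<in> {0..h}" for u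
  proof -
    have "((\<lambda>u. y 0 + integral {0..u} (\<lambda>u. F (y u))) has_vector_derivative 0 + F (y u)) (at u within {0..h})"
      by (intro has_vector_derivative_add has_vector_derivative_const integral_has_vector_derivative contFy u)
    then show ?thesis
      unfolding F_def[symmetric]
      by (intro has_vector_derivative_transform[OF u y_int]) auto
  qed
  with y(2) ul y_in show thesis by (rule that)
qed

end

text \<open>The observability-like sets want the point at time 0, so \<open>y\<close> is recentred
  at \<open>u\<close>; negative \<open>a\<close> serves the backward set and positive
  \<open>b\<close> the forward set.\<close>

lemma ode_solution_shift:
  fixes y :: "real \<Rightarrow> 'a::real_normed_vector"
  assumes der: "\<And>u. u \<in> {0..h} \<Longrightarrow> (y has_vector_derivative F (y u)) (at u within {0..h})"
    and cont: "continuous_on {0..h} (\<lambda>u. F (y u))"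
    and ab: "a \<le> b" "0 \<le> u + a" "u + b \<le> h"
  shows "ode_solution (\<lambda>_. F) {a..b} (\<lambda>t. y (u + t))"
proof (rule ode_solution_of_continuous_derivative[OF ab(1)])
  fix t assume t: "t \<in> {a..b}"
  have img: "(\<lambda>t. u + t) ` {a..b} \<subseteq> {0..h}" using ab by auto
  have "((\<lambda>t. u + t) has_vector_derivative 0 + 1) (at t within {a..b})"
    by (intro derivative_intros)
  moreover have "(y has_vector_derivative F (y (u + t))) (at (u + t) within (\<lambda>t. u + t) ` {a..b})"
    using der[of "u + t"] t ab img by (intro has_vector_derivative_within_subset[OF _ img]) auto
  ultimately have "((y \<circ> (\<lambda>t. u + t)) has_vector_derivative (0 + 1) *\<^sub>R F (y (u + t))) (at t within {a..b})"
    by (rule vector_diff_chain_within)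
  then show "((\<lambda>t. y (u + t)) has_vector_derivative F (y (u + t))) (at t within {a..b})"
    by (simp add: o_def)
next
  show "continuous_on {a..b} (\<lambda>t. F (y (u + t)))"
    by (rule continuous_on_compose2[OF cont]) (use ab in \<open>auto intro!: continuous_intros\<close>)
qed

subsection \<open>Trajectories with a decaying Lyapunov-like function\<close>

text \<open>The limit \<open>c\<close> is allowed to depend on the mode, which covers both
  statements of the theorem at once. \<open>V_limit\<close> looks only at late times at which
  \<gamma> is active, and the dwell time is written as \<open>3 * h\<close> so that windows have
  length \<open>h\<close>.\<close>

locale decaying_trajectory = bounded_trajectory domf f x \<sigma> B
  for domf :: "('a::euclidean_space \<times> 'g::{finite,metric_space}) set"
    and f x \<sigma> B +
  fixes domV :: "('a \<times> 'g) set" and V :: "'a \<times> 'g \<Rightarrow> real" and W :: "'g \<Rightarrow> 'a \<Rightarrow> real"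
    and c :: "'g \<Rightarrow> real" and h T :: real
  assumes B_subset: "B \<subseteq> state_dom domV"
    and class_V: "class_V domf domV V"
    and decay: "decay_inequality domf f domV V W"
    and obs: "observability_condition domf f domV W"
    and V_limit: "((\<lambda>t. V (x t, \<gamma>)) \<longlongrightarrow> c \<gamma>) (inf at_top (principal (\<sigma> -` {\<gamma>})))"
    and dwell: "\<sigma> \<in> dwell_time_signals (3 * h)" "0 < h"
    and ergodic: "\<sigma> \<in> ergodic_signals T"
begin

lemma V_differentiable:
  "\<xi> \<in> B \<inter> slice domf \<gamma> \<Longrightarrow> (\<lambda>\<eta>. V (\<eta>, \<gamma>)) differentiable (at \<xi>)"
  using class_V B_subset by (auto simp: class_V_def state_dom_at_def)

text \<open>Differentiability makes \<open>V\<close> in mode \<gamma> continuous at \<xi>, so its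
  values along the sequence tend both to the value at \<xi> and to
  \<open>c \<gamma>\<close>.\<close>

lemma V_limit_sequence:
  fixes u :: "nat \<Rightarrow> real"
  assumes u: "filterlim u at_top sequentially" and mode: "\<forall>\<^sub>F k in sequentially. \<sigma> (u k) = \<gamma>"
    and lim: "(\<lambda>k. x (u k)) \<longlonglongrightarrow> \<xi>" and \<xi>: "\<xi> \<in> B \<inter> slice domf \<gamma>"
  shows "V (\<xi>, \<gamma>) = c \<gamma>"
proof -
  have "filterlim u (inf at_top (principal (\<sigma> -` {\<gamma>}))) sequentially"
    unfolding filterlim_inf filterlim_principal using u mode by simp
  then have "(\<lambda>k. V (x (u k), \<gamma>)) \<longlonglongrightarrow> c \<gamma>"
    using filterlim_compose[OF V_limit] by blast
  moreover have "(\<lambda>k. V (x (u k), \<gamma>)) \<longlonglongrightarrow> V (\<xi>, \<gamma>)"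
    using isCont_tendsto_compose[OF differentiable_imp_continuous_within[OF V_differentiable[OF \<xi>]] lim]
    by simp
  ultimately show ?thesis
    by (rule LIMSEQ_unique[symmetric])
qed

text \<open>As \<open>V\<close> is constant along \<open>y\<close>, its derivative there is 0 and
  the decay inequality squeezes \<open>W\<close> to 0; the observability hypothesis then
  applies.\<close>

lemma limit_curve_equilibrium:
  assumes y_in: "\<And>u. u \<in> {0..h} \<Longrightarrow> y u \<in> B \<inter> slice domf \<gamma>"
    and der: "\<And>u. u \<in> {0..h} \<Longrightarrow> (y has_vector_derivative f (y u, \<gamma>)) (at u within {0..h})"
    and V_const: "\<And>u. u \<in> {0..h} \<Longrightarrow> V (y u, \<gamma>) = c \<gamma>"
    and u: "u \<in> {0..h}"
  shows "f (y u, \<gamma>) = 0"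
proof -
  let ?O = "state_dom_at domf domV \<gamma>"
  have y_O: "y v \<in> ?O" if "v \<in> {0..h}" for v
    using y_in[OF that] B_subset by (auto simp: state_dom_at_def)
  have W0: "W \<gamma> (y v) = 0" if v: "v \<in> {0..h}" for v
  proof -
    let ?D = "frechet_derivative (\<lambda>\<eta>. V (\<eta>, \<gamma>)) (at (y v))"
    have "((\<lambda>\<eta>. V (\<eta>, \<gamma>)) has_derivative ?D) (at (y v))"
      using V_differentiable[OF y_in[OF v]] by (simp add: frechet_derivative_works)
    then have "((\<lambda>\<eta>. V (\<eta>, \<gamma>)) \<circ> y has_vector_derivative ?D (f (y v, \<gamma>))) (at v within {0..h})"
      by (rule vector_derivative_diff_chain_within[OF der[OF v] has_derivative_at_withinI])
    moreover have "((\<lambda>\<eta>. V (\<eta>, \<gamma>)) \<circ> y has_vector_derivative 0) (at v within {0..h})"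
      by (rule has_vector_derivative_transform[OF v _ has_vector_derivative_const[of "c \<gamma>"]])
        (simp add: V_const)
    \<comment> \<open>Derivatives within \<open>{0..h}\<close> are unique, at the endpoints too,
      since \<open>0 < h\<close>.\<close>
    ultimately have "?D (f (y v, \<gamma>)) = 0"
      using vector_derivative_unique_within_closed_interval[of 0 h v] v dwell(2) by simp
    moreover have "- ?D (f (y v, \<gamma>)) \<ge> W \<gamma> (y v) \<and> W \<gamma> (y v) \<ge> 0"
      using decay y_O[OF v] by (simp add: decay_inequality_def)
    ultimately show ?thesis by simp
  qed
  have conty: "continuous_on {0..h} y"
    using der[THEN has_vector_derivative_continuous] by (simp add: continuous_on_eq_continuous_within)
  have cont: "continuous_on {0..h} (\<lambda>u. f (y u, \<gamma>))"
    by (rule continuous_on_compose2[OF continuous_on_slice conty]) (use y_in in auto)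
  have sol: "ode_solution (\<lambda>_ \<xi>. f (\<xi>, \<gamma>)) {a..b} (\<lambda>t. y (v + t))"
    if "a \<le> b" "0 \<le> v + a" "v + b \<le> h" for a b v
    by (rule ode_solution_shift[of h y "\<lambda>\<xi>. f (\<xi>, \<gamma>)"]) (use der cont that in auto)
  \<comment> \<open>From an interior time there is room for \<open>v\<close> backward and
    \<open>h - v\<close> forward, so whichever alternative holds for \<gamma> can be used.\<close>
  have inner: "f (y v, \<gamma>) = 0" if v: "v \<in> {0<..<h}" for v
  proof -
    have "y v \<in> obs_backward_upto ?O (\<lambda>\<xi>. f (\<xi>, \<gamma>)) (W \<gamma>) v"
      unfolding obs_backward_upto_def mem_Collect_eq
      by (intro conjI exI[of _ "\<lambda>t. y (v + t)"] sol) (use v y_O W0 in auto)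
    then have "y v \<in> obs_backward ?O (\<lambda>\<xi>. f (\<xi>, \<gamma>)) (W \<gamma>)"
      using v by (auto simp: obs_backward_def)
    moreover have "y v \<in> obs_forward_upto ?O (\<lambda>\<xi>. f (\<xi>, \<gamma>)) (W \<gamma>) (h - v)"
      unfolding obs_forward_upto_def mem_Collect_eq
      by (intro conjI exI[of _ "\<lambda>t. y (v + t)"] sol) (use v y_O W0 in auto)
    then have "y v \<in> obs_forward ?O (\<lambda>\<xi>. f (\<xi>, \<gamma>)) (W \<gamma>)"
      using v unfolding obs_forward_def by (intro UN_I[of "h - v"]) auto
    ultimately have "y v \<in> equilibria domf f \<gamma>"
      using obs unfolding observability_condition_def by blast
    then show ?thesis by (simp add: equilibria_def)
  qed
  \<comment> \<open>The endpoints follow by continuity from the open interval.\<close>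
  show ?thesis
    by (rule continuous_constant_on_closure[of "{0<..<h}" "\<lambda>u. f (y u, \<gamma>)"])
      (use cont inner u dwell(2) in auto)
qed

text \<open>If the speed stayed at least \<open>e\<close> at late times \<open>t k\<close> of one
  mode, windows around these times would have a limit curve made of equilibria. The states
  \<open>x (t k)\<close> subconverge to a point of that curve, so their velocities subconverge to
  0.\<close>

lemma velocity_tendsto_0: "((\<lambda>t. f (x t, \<sigma> t)) \<longlongrightarrow> 0) at_top"
proof (rule tendstoI)
  fix e :: real assume e: "0 < e"
  have "\<forall>\<^sub>F t in at_top. \<sigma> t = \<gamma> \<longrightarrow> dist (f (x t, \<sigma> t)) 0 < e" for \<gamma>
  proof (rule ccontr)
    assume "\<not> ?thesis"
    then have freq: "\<exists>\<^sub>F t in at_top. \<sigma> t = \<gamma> \<and> e \<le> norm (f (x t, \<sigma> t))"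
      unfolding frequently_def by (simp add: not_le cong: imp_cong)
    \<comment> \<open>The extra condition \<open>h \<le> t\<close> keeps the window, which may begin
      as early as \<open>t - h\<close>, within nonnegative times.\<close>
    have "\<exists>t\<ge>S. h \<le> t \<and> \<sigma> t = \<gamma> \<and> e \<le> norm (f (x t, \<sigma> t))" for S
      using freq[unfolded frequently_at_top_real, rule_format, of "max S h"] by auto
    then have "\<exists>\<^sub>F t in at_top. h \<le> t \<and> \<sigma> t = \<gamma> \<and> e \<le> norm (f (x t, \<sigma> t))"
      by (simp add: frequently_at_top_real)
    from frequently_at_top_sequence[OF this] obtain t :: "nat \<Rightarrow> real"
      where t: "\<And>k. h \<le> t k \<and> \<sigma> (t k) = \<gamma> \<and> e \<le> norm (f (x (t k), \<sigma> (t k)))"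
        "filterlim t at_top sequentially"
      by blast
    have "\<exists>s. t k - h \<le> s \<and> s \<le> t k \<and> (\<forall>u\<in>{s..s + h}. \<sigma> u = \<gamma>)" for k
      using dwell_time_constant_interval[OF dwell, of "t k"] t(1)[of k] by metis
    then obtain s where s: "\<And>k. t k - h \<le> s k" "\<And>k. s k \<le> t k" "\<And>k u. u \<in> {s k..s k + h} \<Longrightarrow> \<sigma> u = \<gamma>"
      by metis
    have s0: "0 \<le> s k" for k
      using s(1)[of k] t(1)[of k] by simp
    have s_top: "filterlim s at_top sequentially"
    proof (rule filterlim_at_top_mono)
      show "filterlim (\<lambda>k. - h + t k) at_top sequentially"
        by (intro filterlim_tendsto_add_at_top[OF tendsto_const] t(2))
    qed (use s(1) in \<open>auto intro!: always_eventually simp: algebra_simps\<close>)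
    obtain y r where r: "strict_mono (r :: nat \<Rightarrow> nat)"
      and ul: "uniform_limit {0..h} (\<lambda>k u. x (s (r k) + u)) y sequentially"
      and y_in: "\<And>u. u \<in> {0..h} \<Longrightarrow> y u \<in> B \<inter> slice domf \<gamma>"
      and der: "\<And>u. u \<in> {0..h} \<Longrightarrow> (y has_vector_derivative f (y u, \<gamma>)) (at u within {0..h})"
      using window_limit[of s h \<gamma>] s0 s(3) dwell(2) by metis
    have "V (y u, \<gamma>) = c \<gamma>" if u: "u \<in> {0..h}" for u
    proof (rule V_limit_sequence)
      show "filterlim (\<lambda>k. s (r k) + u) at_top sequentially"
        by (rule filterlim_at_top_mono[OF filterlim_compose[OF s_top filterlim_subseq[OF r]]])
          (use u in auto)
      show "\<forall>\<^sub>F k in sequentially. \<sigma> (s (r k) + u) = \<gamma>"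
      proof (intro always_eventually allI)
        show "\<sigma> (s (r k) + u) = \<gamma>" for k
          using s(3)[of "s (r k) + u" "r k"] u by simp
      qed
    qed (use u y_in tendsto_uniform_limitI[OF ul u] in auto)
    then have f0: "f (y u, \<gamma>) = 0" if "u \<in> {0..h}" for u
      using limit_curve_equilibrium[of y \<gamma> u] y_in der that by blast
    have conty: "continuous_on {0..h} y"
      using der[THEN has_vector_derivative_continuous] by (simp add: continuous_on_eq_continuous_within)
    \<comment> \<open>The position of \<open>t k\<close> inside its window varies with
      \<open>k\<close>; a second subsequence makes it converge.\<close>
    have "\<forall>k. t (r k) - s (r k) \<in> {0..h}"
      using s(1,2) by (auto simp: algebra_simps)
    then obtain \<theta> q where \<theta>: "\<theta> \<in> {0..h}" "strict_mono (q :: nat \<Rightarrow> nat)"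
      "((\<lambda>k. t (r k) - s (r k)) \<circ> q) \<longlonglongrightarrow> \<theta>"
      by (rule seq_compactE[OF compact_imp_seq_compact[OF compact_Icc]])
    define \<theta>' where "\<theta>' k = t (r (q k)) - s (r (q k))" for k
    have \<theta>': "\<theta>' k \<in> {0..h}" "x (t (r (q k))) = x (s (r (q k)) + \<theta>' k)" for k
      using s(1,2)[of "r (q k)"] by (auto simp: \<theta>'_def)
    have "\<theta>' \<longlonglongrightarrow> \<theta>"
      using \<theta>(3) by (simp add: \<theta>'_def[abs_def] o_def)
    then have "(\<lambda>k. y (\<theta>' k)) \<longlonglongrightarrow> y \<theta>"
      by (rule continuous_on_tendsto_compose[OF conty _ \<theta>(1)]) (simp add: \<theta>'(1)[simplified])
    \<comment> \<open>Uniform convergence on the window permits evaluation at the moving positions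
      \<open>\<theta>' k\<close>.\<close>
    moreover have "(\<lambda>k. x (t (r (q k))) - y (\<theta>' k)) \<longlonglongrightarrow> 0"
    proof (rule tendstoI)
      fix \<epsilon> :: real assume "0 < \<epsilon>"
      then have "\<forall>\<^sub>F k in sequentially. \<forall>u\<in>{0..h}. dist (x (s (r k) + u)) (y u) < \<epsilon>"
        using ul by (simp add: uniform_limit_iff)
      then have "\<forall>\<^sub>F k in sequentially. \<forall>u\<in>{0..h}. dist (x (s (r (q k)) + u)) (y u) < \<epsilon>"
        by (rule eventually_compose_filterlim[OF _ filterlim_subseq[OF \<theta>(2)]])
      then show "\<forall>\<^sub>F k in sequentially. dist (x (t (r (q k))) - y (\<theta>' k)) 0 < \<epsilon>"
        by eventually_elim (use \<theta>' in \<open>simp add: dist_norm\<close>)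
    qed
    ultimately have "(\<lambda>k. x (t (r (q k)))) \<longlonglongrightarrow> y \<theta>"
      using tendsto_add by fastforce
    moreover have "x (t k) \<in> slice domf \<gamma>" for k
      using in_domf[of "t k"] t(1)[of k] dwell(2) by (simp add: slice_def)
    ultimately have "(\<lambda>k. f (x (t (r (q k))), \<gamma>)) \<longlonglongrightarrow> f (y \<theta>, \<gamma>)"
      using y_in[OF \<theta>(1)] by (intro continuous_on_tendsto_compose[OF continuous_on_slice]) auto
    then have "(\<lambda>k. norm (f (x (t (r (q k))), \<gamma>))) \<longlonglongrightarrow> 0"
      using f0[OF \<theta>(1)] tendsto_norm_zero by metis
    moreover have "e \<le> norm (f (x (t k), \<gamma>))" for k
      using t(1)[of k] by metis
    ultimately have "e \<le> 0"
      by (intro tendsto_lowerbound[OF _ _ sequentially_bot]) auto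
    with e show False by simp
  qed
  then show "\<forall>\<^sub>F t in at_top. dist (f (x t, \<sigma> t)) 0 < e"
    using eventually_all_finite[of "\<lambda>t \<gamma>. \<sigma> t = \<gamma> \<longrightarrow> dist (f (x t, \<sigma> t)) 0 < e" at_top] by simp
qed

section \<open>Limit points of the trajectory\<close>

lemma displacement_tendsto_0:
  fixes t u :: "nat \<Rightarrow> real"
  assumes t: "filterlim t at_top sequentially"
    and u: "\<And>k. t k \<le> u k" "\<And>k. u k \<le> t k + L"
  shows "(\<lambda>k. x (u k) - x (t k)) \<longlonglongrightarrow> 0"
proof (rule tendstoI)
  fix e :: real assume e: "0 < e"
  have L: "0 \<le> L" using u[of 0] by simp
  \<comment> \<open>Chosen so that \<open>d * (L + 1)\<close> equals \<open>e / 2\<close>; the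
    summand 1 keeps the denominator positive when \<open>L\<close> is 0.\<close>
  define d where "d = e / (2 * (L + 1))"
  have d: "0 < d" using e L by (simp add: d_def)
  have "\<forall>\<^sub>F t in at_top. norm (f (x t, \<sigma> t)) < d"
    using tendstoD[OF velocity_tendsto_0 d] by simp
  then obtain S where S: "\<And>t. S \<le> t \<Longrightarrow> norm (f (x t, \<sigma> t)) < d"
    by (auto simp: eventually_at_top_linorder)
  have "\<forall>\<^sub>F k in sequentially. max S 0 \<le> t k"
    using t unfolding filterlim_at_top by blast
  then show "\<forall>\<^sub>F k in sequentially. dist (x (u k) - x (t k)) 0 < e"
  proof eventually_elim
    case (elim k)
    have "norm (x (u k) - x (t k)) \<le> d * (u k - t k)"
      using elim u[of k] d by (intro displacement_le less_imp_le[OF S]) auto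
    also have "\<dots> \<le> d * (L + 1)"
      using u[of k] d by (intro mult_left_mono) auto
    also have "\<dots> = e / 2"
      using L by (simp add: d_def field_simps)
    also have "\<dots> < e"
      using e by simp
    finally show ?case by simp
  qed
qed

text \<open>For each mode \<gamma>, ergodicity moves the times \<open>t k\<close> by a bounded
  amount to times \<open>u k\<close> at which \<gamma> is active. The displacement tends to 0, so
  the same point is approached in every mode, and continuity in that mode identifies it as an
  equilibrium with the right value of \<open>V\<close>.\<close>

lemma omega_limits_subset:
  "omega_limits x \<subseteq> (\<Inter>\<gamma>. equilibria domf f \<gamma> \<inter> state_dom_at domf domV \<gamma> \<inter> level_set domV V \<gamma> (c \<gamma>))"
proof (intro subsetI INT_I)
  fix \<xi> \<gamma> assume "\<xi> \<in> omega_limits x"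
  then obtain t :: "nat \<Rightarrow> real" where t: "filterlim t at_top sequentially" "(\<lambda>k. x (t k)) \<longlonglongrightarrow> \<xi>"
    by (auto simp: omega_limits_def)
  \<comment> \<open>Ergodicity speaks of nonnegative times only; for the finitely many negative
    \<open>t k\<close> the dummy \<open>t k\<close> itself is taken. The absolute value of
    \<open>T\<close> keeps the bound valid for it whatever the sign of \<open>T\<close>.\<close>
  have "\<exists>u. t k \<le> u \<and> u \<le> t k + \<bar>T\<bar> \<and> (0 \<le> t k \<longrightarrow> \<sigma> u = \<gamma>)" for k
  proof (cases "0 \<le> t k")
    case True
    then have "\<sigma> -` {\<gamma>} \<inter> {t k..t k + T} \<noteq> {}"
      using ergodic by (simp add: ergodic_signals_def)
    then obtain u where "u \<in> {t k..t k + T}" "\<sigma> u = \<gamma>" by blast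
    then show ?thesis by (intro exI[of _ u]) auto
  qed (intro exI[of _ "t k"], simp)
  then obtain u where u: "\<And>k. t k \<le> u k" "\<And>k. u k \<le> t k + \<bar>T\<bar>" "\<And>k. 0 \<le> t k \<Longrightarrow> \<sigma> (u k) = \<gamma>"
    by metis
  have u_top: "filterlim u at_top sequentially"
    using u(1) by (intro filterlim_at_top_mono[OF t(1)] always_eventually) auto
  have ev0: "\<forall>\<^sub>F k in sequentially. 0 \<le> t k"
    using t(1) unfolding filterlim_at_top by blast
  have mode: "\<forall>\<^sub>F k in sequentially. \<sigma> (u k) = \<gamma>"
    using ev0 by eventually_elim (rule u(3))
  have xu: "(\<lambda>k. x (u k)) \<longlonglongrightarrow> \<xi>"
    using tendsto_add[OF displacement_tendsto_0[OF t(1) u(1,2)] t(2)] by simp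
  have ev: "\<forall>\<^sub>F k in sequentially. x (u k) \<in> B \<inter> slice domf \<gamma>"
    using ev0
  proof eventually_elim
    case (elim k)
    then show ?case
      using x_in_B[of "u k"] in_domf[of "u k"] u(1)[of k] u(3)[of k] by (simp add: slice_def)
  qed
  have \<xi>: "\<xi> \<in> B \<inter> slice domf \<gamma>"
    by (rule Lim_in_closed_set[OF compact_imp_closed[OF compact_slice] ev sequentially_bot xu])
  have "(\<lambda>k. f (x (u k), \<gamma>)) \<longlonglongrightarrow> f (\<xi>, \<gamma>)"
    using \<xi> ev by (intro continuous_on_tendsto_compose[OF continuous_on_slice xu]) (auto elim: eventually_mono)
  moreover have "(\<lambda>k. f (x (u k), \<gamma>)) \<longlonglongrightarrow> 0"
  proof (rule Lim_transform_eventually)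
    show "(\<lambda>k. f (x (u k), \<sigma> (u k))) \<longlonglongrightarrow> 0"
      by (rule filterlim_compose[OF velocity_tendsto_0 u_top])
    show "\<forall>\<^sub>F k in sequentially. f (x (u k), \<sigma> (u k)) = f (x (u k), \<gamma>)"
      using mode by eventually_elim simp
  qed
  ultimately have "f (\<xi>, \<gamma>) = 0"
    by (rule LIMSEQ_unique)
  moreover have "V (\<xi>, \<gamma>) = c \<gamma>"
    by (rule V_limit_sequence[OF u_top mode xu \<xi>])
  moreover have "\<xi> \<in> state_dom_at domf domV \<gamma>"
    using \<xi> B_subset by (auto simp: state_dom_at_def)
  ultimately show "\<xi> \<in> equilibria domf f \<gamma> \<inter> state_dom_at domf domV \<gamma> \<inter> level_set domV V \<gamma> (c \<gamma>)"
    using \<xi> class_V by (auto simp: equilibria_def level_set_def class_V_def)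
qed

text \<open>The superset \<open>M\<close> accommodates the two targets: equilibria in a level set,
  and equilibria in the state domain.\<close>

lemma converges_to_set_x:
  assumes "(\<Inter>\<gamma>. equilibria domf f \<gamma> \<inter> state_dom_at domf domV \<gamma> \<inter> level_set domV V \<gamma> (c \<gamma>)) \<subseteq> M"
  shows "converges_to_set x M"
  by (rule converges_to_set_if_omega_limits_subset[OF compact_B])
    (use x_in_B omega_limits_subset assms in auto)

text \<open>Compactness provides a limit point, and discreteness of \<open>M\<close> isolates it, so
  the whole curve converges to it.\<close>

lemma converges_to_equilibrium:
  assumes sub: "(\<Inter>\<gamma>. equilibria domf f \<gamma> \<inter> state_dom_at domf domV \<gamma> \<inter> level_set domV V \<gamma> (c \<gamma>)) \<subseteq> M"
    and M: "discrete M"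
  obtains xe where "xe \<in> (\<Inter>\<gamma>. equilibria domf f \<gamma> \<inter> state_dom_at domf domV \<gamma>)" "(x \<longlongrightarrow> xe) at_top"
proof -
  have "omega_limits x \<noteq> {}"
    using converges_to_set_if_omega_limits_subset[OF compact_B x_in_B order_refl]
    by (simp add: converges_to_set_def)
  then obtain xe where xe: "xe \<in> omega_limits x" by blast
  have \<Omega>M: "omega_limits x \<subseteq> M"
    using omega_limits_subset sub by (rule order_trans)
  have "(x \<longlongrightarrow> xe) at_top"
    by (rule tendsto_if_isolated_omega_limit[OF continuous_on_x compact_B _ \<Omega>M xe])
      (use x_in_B discreteD[OF M] xe \<Omega>M in auto)
  moreover have "xe \<in> (\<Inter>\<gamma>. equilibria domf f \<gamma> \<inter> state_dom_at domf domV \<gamma>)"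
    using xe omega_limits_subset by blast
  ultimately show thesis using that by blast
qed

end

section \<open>Monotone limits and the two statements\<close>

text \<open>Taking \<open>A\<close> to be all times or the times of one mode covers both
  monotonicity hypotheses. Once a value at some time of \<open>A\<close> is within \<open>e\<close>
  of the infimum, all later values on \<open>A\<close> are.\<close>

lemma antimono_on_tendsto_Inf:
  fixes v :: "real \<Rightarrow> real"
  assumes mono: "antimono_on (A \<inter> {0..}) v" and bdd: "bdd_below (v ` (A \<inter> {0..}))"
    and ne: "A \<inter> {0..} \<noteq> {}"
  shows "(v \<longlongrightarrow> Inf (v ` (A \<inter> {0..}))) (inf at_top (principal A))"
proof (rule tendstoI)
  let ?c = "Inf (v ` (A \<inter> {0..}))"
  fix e :: real assume "0 < e"
  then have "?c < ?c + e" by simp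
  then obtain a where a: "a \<in> A \<inter> {0..}" "v a < ?c + e"
    using cInf_lessD[of "v ` (A \<inter> {0..})" "?c + e"] ne by blast
  have "dist (v t) ?c < e" if t: "a \<le> t" "t \<in> A" for t
  proof -
    have tA: "t \<in> A \<inter> {0..}" using t a by auto
    then have "?c \<le> v t" using bdd by (intro cInf_lower) auto
    moreover have "v t \<le> v a" using mono a(1) tA t(1) by (auto simp: monotone_on_def)
    ultimately show ?thesis using a(2) by (simp add: dist_real_def)
  qed
  then show "\<forall>\<^sub>F t in inf at_top (principal A). dist (v t) ?c < e"
    unfolding eventually_inf_principal eventually_at_top_linorder by blast
qed

theorem theorem4p2:
  fixes domf :: "((real ^ 'n) \<times> 'g::{finite,metric_space}) set"
    and f :: "(real ^ 'n) \<times> 'g \<Rightarrow> real ^ 'n"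
    and I :: "real set"
    and x :: "real \<Rightarrow> real ^ 'n"
    and \<sigma> :: "real \<Rightarrow> 'g"
  assumes "closed domf"
    and "continuous_on domf f"
    and "\<sigma> \<in> Se \<inter> Sd"
    and "trajectory domf f I x \<sigma>"
    and "{0..} \<subseteq> I"
  shows
    "(\<forall>(domV :: ((real ^ 'n) \<times> 'g) set) (V :: (real ^ 'n) \<times> 'g \<Rightarrow> real)
        (W :: 'g \<Rightarrow> real ^ 'n \<Rightarrow> real).
        class_V domf domV V \<and>
        continuous_on (domf \<inter> (state_dom domV \<times> UNIV)) V \<and>
        precompact_relative I x (state_dom domV) \<and>
        antimono_on {0..} (\<lambda>t. V (x t, \<sigma> t)) \<and>
        decay_inequality domf f domV V W \<and>
        observability_condition domf f domV W \<longrightarrow>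
          (\<exists>c. converges_to_set x (\<Inter>\<gamma>. equilibria domf f \<gamma> \<inter> level_set domV V \<gamma> c)) \<and>
          ((\<forall>c. discrete (\<Inter>\<gamma>. equilibria domf f \<gamma> \<inter> level_set domV V \<gamma> c)) \<longrightarrow>
             (\<exists>xe \<in> (\<Inter>\<gamma>. equilibria domf f \<gamma> \<inter> state_dom_at domf domV \<gamma>).
                (x \<longlongrightarrow> xe) at_top)))
     \<and>
     (\<forall>(domV :: ((real ^ 'n) \<times> 'g) set) (V :: (real ^ 'n) \<times> 'g \<Rightarrow> real)
        (W :: 'g \<Rightarrow> real ^ 'n \<Rightarrow> real).
        class_V domf domV V \<and>
        precompact_relative I x (state_dom domV) \<and>
        (\<forall>\<gamma>. antimono_on (\<sigma> -` {\<gamma>} \<inter> {0..}) (\<lambda>t. V (x t, \<sigma> t))) \<and>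
        decay_inequality domf f domV V W \<and>
        observability_condition domf f domV W \<longrightarrow>
          converges_to_set x (\<Inter>\<gamma>. equilibria domf f \<gamma> \<inter> state_dom_at domf domV \<gamma>) \<and>
          (discrete (\<Inter>\<gamma>. equilibria domf f \<gamma> \<inter> state_dom_at domf domV \<gamma>) \<longrightarrow>
             (\<exists>xe \<in> (\<Inter>\<gamma>. equilibria domf f \<gamma> \<inter> state_dom_at domf domV \<gamma>).
                (x \<longlongrightarrow> xe) at_top)))"
proof -
  obtain \<tau> where \<tau>: "0 < \<tau>" "\<sigma> \<in> dwell_time_signals \<tau>"
    using assms(3) by (auto simp: Sd_def)
  obtain T where T: "\<sigma> \<in> ergodic_signals T"
    using assms(3) by (auto simp: Se_def)
  \<comment> \<open>Each mode already occurs in \<open>{0..T}\<close>, so the infimum over its times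
    is not taken over the empty set.\<close>
  have mode_nonempty: "\<sigma> -` {\<gamma>} \<inter> {0..} \<noteq> {}" for \<gamma>
  proof -
    have "\<sigma> -` {\<gamma>} \<inter> {0..0 + T} \<noteq> {}"
      using T unfolding ergodic_signals_def by blast
    then show ?thesis by fastforce
  qed
  have traj: "(x t, \<sigma> t) \<in> domf" if "0 \<le> t" for t
    using that assms(4,5) by (auto simp: trajectory_def)
  have ode: "ode_solution (\<lambda>t \<xi>. f (\<xi>, \<sigma> t)) I x"
    using assms(4) by (simp add: trajectory_def)
  have vel: "((\<lambda>t. f (x t, \<sigma> t)) has_integral x b - x a) {a..b}" if ab: "0 \<le> a" "a \<le> b" for a b
  proof (rule absolutely_continuous_has_integral_vector_derivative[OF ab(2)])
    have sub: "{a..b} \<subseteq> I" using ab(1) assms(5) by auto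
    then show "absolutely_continuous_on_interval a b x"
      using ode by (simp add: ode_solution_def locally_absolutely_continuous_on_def)
    have "AE t in lebesgue. t \<in> I \<longrightarrow> (x has_vector_derivative f (x t, \<sigma> t)) (at t within I)"
      using ode by (simp add: ode_solution_def)
    then show "AE t in lebesgue. t \<in> {a..b} \<longrightarrow> (x has_vector_derivative f (x t, \<sigma> t)) (at t within {a..b})"
      by eventually_elim (use sub has_vector_derivative_within_subset in blast)
  qed
  have bounded: "bounded_trajectory domf f x \<sigma> B" if "compact B" "\<And>t. t \<in> I \<Longrightarrow> x t \<in> B" for B
    by unfold_locales (use assms(1,2,5) that traj vel in auto)
  \<comment> \<open>Only finitely many sections of \<open>V\<close> are involved, each continuous on
    the compact part of \<open>B\<close> in its mode.\<close>
  have bdd: "bdd_below ((\<lambda>t. V (x t, \<sigma> t)) ` {0..})"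
    if V: "class_V domf domV V" and B: "compact B" "B \<subseteq> state_dom domV" "\<And>t. t \<in> I \<Longrightarrow> x t \<in> B"
    for domV and V :: "(real ^ 'n) \<times> 'g \<Rightarrow> real" and B
  proof -
    interpret bounded_trajectory domf f x \<sigma> B using B by (intro bounded)
    have "bounded ((\<lambda>\<xi>. V (\<xi>, \<gamma>)) ` (B \<inter> slice domf \<gamma>))" for \<gamma>
    proof (intro compact_imp_bounded compact_continuous_image compact_slice continuous_at_imp_continuous_on ballI)
      fix \<xi> assume "\<xi> \<in> B \<inter> slice domf \<gamma>"
      then have "(\<lambda>\<eta>. V (\<eta>, \<gamma>)) differentiable (at \<xi>)"
        using V B(2) by (auto simp: class_V_def state_dom_at_def)
      then show "isCont (\<lambda>\<eta>. V (\<eta>, \<gamma>)) \<xi>"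
        by (rule differentiable_imp_continuous_within)
    qed
    then have "bounded (\<Union>\<gamma>. (\<lambda>\<xi>. V (\<xi>, \<gamma>)) ` (B \<inter> slice domf \<gamma>))"
      by (intro bounded_UN) auto
    moreover have "(\<lambda>t. V (x t, \<sigma> t)) ` {0..} \<subseteq> (\<Union>\<gamma>. (\<lambda>\<xi>. V (\<xi>, \<gamma>)) ` (B \<inter> slice domf \<gamma>))"
    proof
      fix z assume "z \<in> (\<lambda>t. V (x t, \<sigma> t)) ` {0..}"
      then obtain t where t: "0 \<le> t" "z = V (x t, \<sigma> t)" by auto
      then have "x t \<in> B \<inter> slice domf (\<sigma> t)"
        using x_in_B in_domf by (simp add: slice_def)
      then show "z \<in> (\<Union>\<gamma>. (\<lambda>\<xi>. V (\<xi>, \<gamma>)) ` (B \<inter> slice domf \<gamma>))"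
        using t(2) by blast
    qed
    ultimately show ?thesis
      by (rule bounded_imp_bdd_below[OF bounded_subset])
  qed
  have mode_limit: "((\<lambda>t. V (x t, \<gamma>)) \<longlongrightarrow> l) (inf at_top (principal (\<sigma> -` {\<gamma>})))"
    if "((\<lambda>t. V (x t, \<sigma> t)) \<longlongrightarrow> l) (inf at_top (principal (\<sigma> -` {\<gamma>})))"
    for V :: "(real ^ 'n) \<times> 'g \<Rightarrow> real" and l \<gamma>
    using that by (rule Lim_transform_eventually) (simp add: eventually_inf_principal)
  \<comment> \<open>The window length is a third of the dwell time.\<close>
  have decaying: "decaying_trajectory domf f x \<sigma> B domV V W c (\<tau> / 3) T"
    if "compact B" "B \<subseteq> state_dom domV" "\<And>t. t \<in> I \<Longrightarrow> x t \<in> B" "class_V domf domV V"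
      "decay_inequality domf f domV V W" "observability_condition domf f domV W"
      "\<And>\<gamma>. ((\<lambda>t. V (x t, \<sigma> t)) \<longlongrightarrow> c \<gamma>) (inf at_top (principal (\<sigma> -` {\<gamma>})))"
    for B domV V W c
    unfolding decaying_trajectory_def decaying_trajectory_axioms_def
    using that bounded mode_limit \<tau> T by simp
  show ?thesis
  proof (intro conjI allI impI; elim conjE)
    fix domV :: "((real ^ 'n) \<times> 'g) set" and V :: "(real ^ 'n) \<times> 'g \<Rightarrow> real"
      and W :: "'g \<Rightarrow> real ^ 'n \<Rightarrow> real"
    assume V: "class_V domf domV V" and pre: "precompact_relative I x (state_dom domV)"
      and mono: "antimono_on {0..} (\<lambda>t. V (x t, \<sigma> t))"
      and dec: "decay_inequality domf f domV V W" and obs: "observability_condition domf f domV W"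
    obtain B where B: "compact B" "B \<subseteq> state_dom domV" "\<And>t. t \<in> I \<Longrightarrow> x t \<in> B"
      using pre by (auto simp: precompact_relative_def)
    \<comment> \<open>A single limit of \<open>V\<close> along the whole trajectory, hence the same
      number for every mode.\<close>
    define c where "c = Inf ((\<lambda>t. V (x t, \<sigma> t)) ` {0..})"
    have "((\<lambda>t. V (x t, \<sigma> t)) \<longlongrightarrow> c) at_top"
      using antimono_on_tendsto_Inf[of UNIV "\<lambda>t. V (x t, \<sigma> t)"] mono bdd[OF V B] by (simp add: c_def)
    then have lim: "((\<lambda>t. V (x t, \<sigma> t)) \<longlongrightarrow> c) (inf at_top (principal (\<sigma> -` {\<gamma>})))" for \<gamma>
      by (rule tendsto_mono[rotated]) simp
    interpret decaying_trajectory domf f x \<sigma> B domV V W "\<lambda>_. c" "\<tau> / 3" T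
      by (rule decaying[OF B V dec obs lim])
    show "\<exists>c. converges_to_set x (\<Inter>\<gamma>. equilibria domf f \<gamma> \<inter> level_set domV V \<gamma> c)"
      by (intro exI[of _ c] converges_to_set_x) auto
    show "\<exists>xe\<in>\<Inter>\<gamma>. equilibria domf f \<gamma> \<inter> state_dom_at domf domV \<gamma>. (x \<longlongrightarrow> xe) at_top"
      if "\<forall>c. discrete (\<Inter>\<gamma>. equilibria domf f \<gamma> \<inter> level_set domV V \<gamma> c)"
    proof -
      have "discrete (\<Inter>\<gamma>. equilibria domf f \<gamma> \<inter> level_set domV V \<gamma> c)" using that by blast
      then show ?thesis
        by (rule converges_to_equilibrium[rotated]) auto
    qed
  next
    fix domV :: "((real ^ 'n) \<times> 'g) set" and V :: "(real ^ 'n) \<times> 'g \<Rightarrow> real"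
      and W :: "'g \<Rightarrow> real ^ 'n \<Rightarrow> real"
    assume V: "class_V domf domV V" and pre: "precompact_relative I x (state_dom domV)"
      and mono: "\<forall>\<gamma>. antimono_on (\<sigma> -` {\<gamma>} \<inter> {0..}) (\<lambda>t. V (x t, \<sigma> t))"
      and dec: "decay_inequality domf f domV V W" and obs: "observability_condition domf f domV W"
    obtain B where B: "compact B" "B \<subseteq> state_dom domV" "\<And>t. t \<in> I \<Longrightarrow> x t \<in> B"
      using pre by (auto simp: precompact_relative_def)
    \<comment> \<open>Here monotonicity holds only within a mode, so each mode has a limit of its
      own.\<close>
    define c where "c \<gamma> = Inf ((\<lambda>t. V (x t, \<sigma> t)) ` (\<sigma> -` {\<gamma>} \<inter> {0..}))" for \<gamma>
    have lim: "((\<lambda>t. V (x t, \<sigma> t)) \<longlongrightarrow> c \<gamma>) (inf at_top (principal (\<sigma> -` {\<gamma>})))" for \<gamma>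
      unfolding c_def
    proof (rule antimono_on_tendsto_Inf)
      show "bdd_below ((\<lambda>t. V (x t, \<sigma> t)) ` (\<sigma> -` {\<gamma>} \<inter> {0..}))"
        using bdd[OF V B] by (rule bdd_below_mono) auto
    qed (use mono mode_nonempty in auto)
    interpret decaying_trajectory domf f x \<sigma> B domV V W c "\<tau> / 3" T
      by (rule decaying[OF B V dec obs lim])
    show "converges_to_set x (\<Inter>\<gamma>. equilibria domf f \<gamma> \<inter> state_dom_at domf domV \<gamma>)"
      by (rule converges_to_set_x) auto
    show "\<exists>xe\<in>\<Inter>\<gamma>. equilibria domf f \<gamma> \<inter> state_dom_at domf domV \<gamma>. (x \<longlongrightarrow> xe) at_top"
      if "discrete (\<Inter>\<gamma>. equilibria domf f \<gamma> \<inter> state_dom_at domf domV \<gamma>)"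
      using that by (rule converges_to_equilibrium[rotated]) auto
  qed
qed

end
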